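(* Let $A=\{\mathbf{a}_1,\ldots,\mathbf{a}_p\}\subset\mathbb{N}^n$ and $\mathbf{b}\in\mathbb{N}^n$. Suppose that $\langle A\rangle$ and $\langle\mathbf{b}\rangle$ can be glued, and let $\langle C\rangle$ be a gluing of $\langle A\rangle$ and $\langle\mathbf{b}\rangle$. Then $\dim k[A]=\dim k[C]$ and $\operatorname{depth}(k[A])=\operatorname{depth}(k[C])$. In particular, $k[C]$ is Cohen-Macaulay if and only if $k[A]$ is Cohen-Macaulay.
   Context: Here $\mathbb{N}=\{0,1,2,\ldots\}$, $n\ge 1$, and $k$ is an arbitrary field. All generators of semigroups are nonzero vectors. For $A=\{\mathbf{a}_1,\ldots,\mathbf{a}_p\}\subset\mathbb{N}^n$, $\langle A\rangle$ is the semigroup of all $\mathbb{N}$-linear combinations of elements of $A$; $I_A$ is the kernel of the $k$-algebra map $k[x_1,\ldots,x_p]\to k[t_1,\ldots,t_n]$, $x_j\mapsto t^{\mathbf{a}_j}=\prod_{i=1}^n t_i^{a_{ij}}$, and $k[A]\simeq k[x_1,\ldots,x_p]/I_A$ is the semigroup ring. For positive integers $k_1,k_2$ and $C=k_1A\cup\{k_2\mathbf{b}\}$, let $I_C\subset R=k[x_1,\ldots,x_p,y]$ be the kernel of the $k$-algebra map $R\to k[t_1,\ldots,t_n]$, $x_i\mapsto t^{k_1\mathbf{a}_i}$, $y\mapsto t^{k_2\mathbf{b}}$, and $k[C]\simeq R/I_C$. One says that $\langle C\rangle$ is a gluing of $\langle A\rangle$ and $\langle\mathbf{b}\rangle$ if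 $I_C=I_AR+\langle\rho\rangle$ for some nonzero binomial $\rho=x_1^{\alpha_1}\cdots x_p^{\alpha_p}-y^{\beta}$ with $\alpha\in\mathbb{N}^p$, $\beta\in\mathbb{N}$. The semigroups $\langle A\rangle$ and $\langle\mathbf{b}\rangle$ can be glued if such a gluing exists for some positive integers $k_1,k_2$. $\dim$ is Krull dimension, and depth is taken with respect to the homogeneous maximal ideal (generated by the images of all the variables), the rings being graded by giving each variable the degree of its image in $\mathbb{N}^n$. *)

theory Defs
  imports
    "HOL-Library.Poly_Mapping"
    "HOL-Library.Extended_Nat"
    "HOL-Analysis.Finite_Cartesian_Product"
    "HOL-Algebra.QuotRing"
    "HOL-Algebra.Algebraic_Closure_Type"
begin

definition krull_dim :: "('a, 'm) ring_scheme \<Rightarrow> enat" where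
  "krull_dim R =
     Sup {enat n | n. \<exists>P :: nat \<Rightarrow> 'a set.
            (\<forall>i\<le>n. primeideal (P i) R) \<and> (\<forall>i<n. P i \<subset> P (Suc i))}"

text \<open>
  The second conjunct says that each \<open>xs ! i\<close> is a nonzerodivisor modulo the preceding
  elements.
\<close>
definition regular_sequence :: "('a, 'm) ring_scheme \<Rightarrow> 'a list \<Rightarrow> bool" where
  "regular_sequence R xs \<longleftrightarrow>
     set xs \<subseteq> carrier R \<and>
     (\<forall>i<length xs. \<forall>r\<in>carrier R.
        r \<otimes>\<^bsub>R\<^esub> (xs ! i) \<in> Idl\<^bsub>R\<^esub> (set (take i xs)) \<longrightarrow> r \<in> Idl\<^bsub>R\<^esub> (set (take i xs))) \<and>
     Idl\<^bsub>R\<^esub> (set xs) \<noteq> carrier R"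

text \<open>The elements of the sequence need not be homogeneous.\<close>
definition depth :: "('a, 'm) ring_scheme \<Rightarrow> 'a set \<Rightarrow> enat" where
  "depth R I = Sup {enat (length xs) | xs. regular_sequence R xs \<and> set xs \<subseteq> I}"

type_synonym ('v, 'k) mpol = "('v \<Rightarrow>\<^sub>0 nat) \<Rightarrow>\<^sub>0 'k"

definition mpol_const :: "'k \<Rightarrow> ('v, 'k::comm_ring_1) mpol" where
  "mpol_const c = Poly_Mapping.single 0 c"

definition mpol_var :: "'v \<Rightarrow> ('v, 'k::comm_ring_1) mpol" where
  "mpol_var v = Poly_Mapping.single (Poly_Mapping.single v 1) 1"

text \<open>The \<open>k\<close>-algebra homomorphism sending each variable \<open>v\<close> to \<open>\<phi> v\<close>.\<close>
definition mpol_subst :: "('v \<Rightarrow> ('w, 'k) mpol) \<Rightarrow> ('v, 'k::comm_ring_1) mpol \<Rightarrow> ('w, 'k) mpol"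
  where
  "mpol_subst \<phi> f =
     (\<Sum>m\<in>Poly_Mapping.keys f.
        mpol_const (Poly_Mapping.lookup f m) *
        (\<Prod>v\<in>Poly_Mapping.keys m. \<phi> v ^ Poly_Mapping.lookup m v))"

abbreviation mpol_ring :: "('v, 'k::comm_ring_1) mpol ring" where
  "mpol_ring \<equiv> ring_of_type_algebra"

text \<open>
  A finite list of generators in \<open>\<nat>\<^sup>n\<close> is a family \<open>a :: 'p \<Rightarrow> nat ^ 'n\<close> indexed by a finite
  type. The field \<open>k\<close> is passed as a type argument, since it does not occur in the generators.
\<close>

definition toric_map :: "('p \<Rightarrow> nat ^ 'n) \<Rightarrow> ('p, 'k::field) mpol \<Rightarrow> ('n, 'k) mpol" where
  "toric_map a = mpol_subst (\<lambda>j. \<Prod>i\<in>UNIV. mpol_var i ^ (a j $ i))"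

definition toric_ideal :: "'k::field itself \<Rightarrow> ('p \<Rightarrow> nat ^ 'n) \<Rightarrow> ('p, 'k) mpol set" where
  "toric_ideal k a = a_kernel mpol_ring mpol_ring (toric_map a)"

definition semigroup_ring ::
    "'k::field itself \<Rightarrow> ('p \<Rightarrow> nat ^ 'n) \<Rightarrow> ('p, 'k) mpol set ring" where
  "semigroup_ring k a = mpol_ring Quot (toric_ideal k a)"

definition homogeneous_maximal_ideal ::
    "'k::field itself \<Rightarrow> ('p \<Rightarrow> nat ^ 'n) \<Rightarrow> ('p, 'k) mpol set set" where
  "homogeneous_maximal_ideal k a =
     Idl\<^bsub>semigroup_ring k a\<^esub> (range (\<lambda>j. toric_ideal k a +>\<^bsub>mpol_ring\<^esub> mpol_var j))"

definition semigroup_ring_dim :: "'k::field itself \<Rightarrow> ('p \<Rightarrow> nat ^ 'n) \<Rightarrow> enat" where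
  "semigroup_ring_dim k a = krull_dim (semigroup_ring k a)"

definition semigroup_ring_depth :: "'k::field itself \<Rightarrow> ('p \<Rightarrow> nat ^ 'n) \<Rightarrow> enat" where
  "semigroup_ring_depth k a = depth (semigroup_ring k a) (homogeneous_maximal_ideal k a)"

text \<open>
  Cohen-Macaulayness in the graded sense: depth with respect to the homogeneous maximal ideal
  equals Krull dimension.
\<close>
definition semigroup_ring_CM :: "'k::field itself \<Rightarrow> ('p \<Rightarrow> nat ^ 'n) \<Rightarrow> bool" where
  "semigroup_ring_CM k a \<longleftrightarrow> semigroup_ring_depth k a = semigroup_ring_dim k a"

text \<open>
  The family \<open>k\<^sub>1 a\<^sub>1, \<dots>, k\<^sub>1 a\<^sub>p, k\<^sub>2 b\<close>: the variable \<open>x\<^sub>j\<close> is indexed by \<open>Some j\<close> and the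
  additional variable \<open>y\<close> by \<open>None\<close>.
\<close>
definition glue_family ::
    "nat \<Rightarrow> nat \<Rightarrow> ('p \<Rightarrow> nat ^ 'n) \<Rightarrow> nat ^ 'n \<Rightarrow> 'p option \<Rightarrow> nat ^ 'n" where
  "glue_family k1 k2 a b j = (case j of Some i \<Rightarrow> k1 *s a i | None \<Rightarrow> k2 *s b)"

definition mpol_incl :: "('p, 'k::comm_ring_1) mpol \<Rightarrow> ('p option, 'k) mpol" where
  "mpol_incl = mpol_subst (\<lambda>j. mpol_var (Some j))"

definition gluing_binomial :: "('p::finite \<Rightarrow> nat) \<Rightarrow> nat \<Rightarrow> ('p option, 'k::comm_ring_1) mpol" where
  "gluing_binomial \<alpha> \<beta> =
     (\<Prod>j\<in>UNIV. mpol_var (Some j) ^ \<alpha> j) - mpol_var None ^ \<beta>"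

definition is_gluing ::
    "'k::field itself \<Rightarrow> nat \<Rightarrow> nat \<Rightarrow> ('p::finite \<Rightarrow> nat ^ 'n) \<Rightarrow> nat ^ 'n \<Rightarrow> bool" where
  "is_gluing k k1 k2 a b \<longleftrightarrow>
     0 < k1 \<and> 0 < k2 \<and>
     (\<exists>\<alpha> \<beta>. (gluing_binomial \<alpha> \<beta> :: ('p option, 'k) mpol) \<noteq> 0 \<and>
        toric_ideal k (glue_family k1 k2 a b) =
          Idl\<^bsub>mpol_ring\<^esub> (mpol_incl ` toric_ideal k a) <+>\<^bsub>mpol_ring\<^esub>
          Idl\<^bsub>mpol_ring\<^esub> {gluing_binomial \<alpha> \<beta>})"

definition can_be_glued ::
    "'k::field itself \<Rightarrow> ('p::finite \<Rightarrow> nat ^ 'n) \<Rightarrow> nat ^ 'n \<Rightarrow> bool" where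
  "can_be_glued k a b \<longleftrightarrow> (\<exists>k1 k2. is_gluing k k1 k2 a b)"

end

(* Let S = k[k1 A], which is isomorphic to k[A], and T = k[C]; both are realised as subrings of
   k[t_1, ..., t_n]. Writing y = t^(k2 b), the hypothesis I_C = I_A R + (x^alpha - y^beta) says that
   T is a free S-module with basis 1, y, ..., y^(beta - 1), where y^beta = x^alpha lies in S; since
   A and b are nonzero, beta > 0 and x^alpha lies in the maximal ideal of S.

   Dimension: primes of S lift along descending chains because T is free over S (going down), and
   comparable primes of T with the same contraction agree because T is algebraic over S.

   Depth: a sequence in S is regular on S iff it is regular on T, by freeness. Conversely a regular
   sequence in the maximal ideal of T can be exchanged, term by term, for one of the same length in
   the maximal ideal of S: prime avoidance yields an element of the latter outside the finitely
   many associated primes involved, because a prime of T that contains the maximal ideal of S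
   contains y^beta, hence y. *)
theory Submission
  imports Defs
begin

subsection \<open>Ideals of subrings\<close>

text \<open>Both rings are kept as subsets of one commutative ring type, so contraction of ideals is
  intersection and no coset arithmetic is needed. Quotient rings appear only where an isomorphism
  carries dimension and depth across.

  Depth admits inhomogeneous sequences in a ring that is not local, and \<open>k\<close> may be
  finite, so a generic linear combination of generators need not exist. What remains available is
  prime avoidance, with primes of the large ring and an ideal of the small one. In the exchange, the
  new element takes the place of the last term but is moved to the front: the rest is then a shorter
  regular sequence modulo a larger ideal, ready for induction.

  In the freeness claim, linear independence is the delicate half. It is read off from the
  coefficients of the remainder on division by \<open>y^\<beta> - x^\<alpha>\<close>. These are not
  ring homomorphisms, only linear over the polynomials in the variables \<open>x\<close>, and they
  vanish on the toric ideal of \<open>C\<close> because they kill all multiples of both kinds of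
  generators. Nonzero generators matter through evaluation at the origin, which kills every
  generator but not 1.\<close>

definition is_subring :: "'r::comm_ring_1 set \<Rightarrow> bool" where
  "is_subring A \<longleftrightarrow> 1 \<in> A \<and> (\<forall>x\<in>A. \<forall>y\<in>A. x - y \<in> A \<and> x * y \<in> A)"

definition ideal_in :: "'r::comm_ring_1 set \<Rightarrow> 'r set \<Rightarrow> bool" where
  "ideal_in A I \<longleftrightarrow>
     I \<subseteq> A \<and> 0 \<in> I \<and> (\<forall>x\<in>I. \<forall>y\<in>I. x + y \<in> I) \<and> (\<forall>a\<in>A. \<forall>x\<in>I. a * x \<in> I)"

definition prime_in :: "'r::comm_ring_1 set \<Rightarrow> 'r set \<Rightarrow> bool" where
  "prime_in A P \<longleftrightarrow>
     ideal_in A P \<and> 1 \<notin> P \<and> (\<forall>x\<in>A. \<forall>y\<in>A. x * y \<in> P \<longrightarrow> x \<in> P \<or> y \<in> P)"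

definition noetherian_in :: "'r::comm_ring_1 set \<Rightarrow> bool" where
  "noetherian_in A \<longleftrightarrow>
     (\<forall>I :: nat \<Rightarrow> 'r set. (\<forall>n. ideal_in A (I n)) \<and> (\<forall>n. I n \<subseteq> I (Suc n)) \<longrightarrow>
        (\<exists>N. \<forall>n\<ge>N. I n = I N))"

lemma is_subring_closed:
  assumes "is_subring A"
  shows "1 \<in> A" "0 \<in> A" "x \<in> A \<Longrightarrow> - x \<in> A" "x \<in> A \<Longrightarrow> y \<in> A \<Longrightarrow> x - y \<in> A"
    "x \<in> A \<Longrightarrow> y \<in> A \<Longrightarrow> x * y \<in> A" "x \<in> A \<Longrightarrow> y \<in> A \<Longrightarrow> x + y \<in> A"
proof -
  show 1: "1 \<in> A" and diff: "\<And>x y. x \<in> A \<Longrightarrow> y \<in> A \<Longrightarrow> x - y \<in> A"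
    and "x \<in> A \<Longrightarrow> y \<in> A \<Longrightarrow> x * y \<in> A"
    using assms by (auto simp: is_subring_def)
  show 0: "0 \<in> A" using diff[OF 1 1] by simp
  show minus: "- x \<in> A" if "x \<in> A" for x using diff[OF 0 that] by simp
  show "x + y \<in> A" if "x \<in> A" "y \<in> A" using diff[OF that(1) minus[OF that(2)]] by simp
qed

lemma is_subring_power: "is_subring A \<Longrightarrow> x \<in> A \<Longrightarrow> x ^ n \<in> A"
  by (induction n) (auto intro: is_subring_closed)

lemma is_subring_sum:
  "is_subring A \<Longrightarrow> (\<And>i. i \<in> Y \<Longrightarrow> f i \<in> A) \<Longrightarrow> (\<Sum>i\<in>Y. f i) \<in> A"
  by (induction Y rule: infinite_finite_induct) (auto intro: is_subring_closed)

lemma is_subring_prod: "is_subring A \<Longrightarrow> (\<And>i. i \<in> Y \<Longrightarrow> f i \<in> A) \<Longrightarrow> prod f Y \<in> A"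
  by (induction Y rule: infinite_finite_induct) (auto intro: is_subring_closed)

lemma ideal_in_closed:
  assumes "ideal_in A I"
  shows "0 \<in> I" "x \<in> I \<Longrightarrow> x \<in> A" "x \<in> I \<Longrightarrow> y \<in> I \<Longrightarrow> x + y \<in> I"
    "a \<in> A \<Longrightarrow> x \<in> I \<Longrightarrow> a * x \<in> I" "a \<in> A \<Longrightarrow> x \<in> I \<Longrightarrow> x * a \<in> I"
  using assms by (auto simp: ideal_in_def mult.commute)

lemma ideal_in_uminus: "is_subring A \<Longrightarrow> ideal_in A I \<Longrightarrow> x \<in> I \<Longrightarrow> - x \<in> I"
  using ideal_in_closed(4)[of A I "-1" x] is_subring_closed(1,3)[of A] by simp

lemma ideal_in_diff: "is_subring A \<Longrightarrow> ideal_in A I \<Longrightarrow> x \<in> I \<Longrightarrow> y \<in> I \<Longrightarrow> x - y \<in> I"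
  using ideal_in_closed(3)[of A I x "- y"] ideal_in_uminus[of A I y] by simp

lemma ideal_in_sum: "ideal_in A I \<Longrightarrow> (\<And>i. i \<in> Y \<Longrightarrow> f i \<in> I) \<Longrightarrow> sum f Y \<in> I"
  by (induction Y rule: infinite_finite_induct) (auto intro: ideal_in_closed(1,3))

lemma ideal_in_zero: "is_subring A \<Longrightarrow> ideal_in A {0}"
  by (auto simp: ideal_in_def intro: is_subring_closed)

lemma ideal_in_restrict:
  "is_subring S \<Longrightarrow> S \<subseteq> T \<Longrightarrow> ideal_in T I \<Longrightarrow> ideal_in S (I \<inter> S)"
  by (auto simp: ideal_in_def intro: is_subring_closed)

lemma prime_in_restrict:
  "is_subring S \<Longrightarrow> S \<subseteq> T \<Longrightarrow> prime_in T P \<Longrightarrow> prime_in S (P \<inter> S)"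
  by (auto simp: prime_in_def ideal_in_restrict intro: is_subring_closed)

text \<open>For an ideal \<open>J\<close> this is the ideal \<open>J + (x)\<close>. The explicit
  form hands over the cofactor \<open>w\<close>, on which the exchange of regular elements
  computes.\<close>

definition add_mult :: "'r::comm_ring_1 set \<Rightarrow> 'r set \<Rightarrow> 'r \<Rightarrow> 'r set" where
  "add_mult A J x = {j + x * w | j w. j \<in> J \<and> w \<in> A}"

lemma ideal_in_add_mult:
  assumes "is_subring A" "ideal_in A J" "x \<in> A"
  shows "ideal_in A (add_mult A J x)"
  unfolding ideal_in_def
proof (intro conjI ballI subsetI)
  note cl = is_subring_closed[OF assms(1)] ideal_in_closed[OF assms(2)]
  show "y \<in> A" if "y \<in> add_mult A J x" for y
    using that assms(3) cl by (auto simp: add_mult_def)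
  show "0 \<in> add_mult A J x"
    using ideal_in_closed(1)[OF assms(2)] is_subring_closed(2)[OF assms(1)]
    by (force simp: add_mult_def)
next
  fix y z assume "y \<in> add_mult A J x" "z \<in> add_mult A J x"
  then obtain j w j' w' where "y = j + x * w" "z = j' + x * w'" "j \<in> J" "j' \<in> J" "w \<in> A" "w' \<in> A"
    by (auto simp: add_mult_def)
  then have "y + z = (j + j') + x * (w + w')" "j + j' \<in> J" "w + w' \<in> A"
    using is_subring_closed[OF assms(1)] ideal_in_closed[OF assms(2)] by (auto simp: algebra_simps)
  then show "y + z \<in> add_mult A J x" by (auto simp: add_mult_def)
next
  fix a y assume "a \<in> A" "y \<in> add_mult A J x"
  then obtain j w where "y = j + x * w" "j \<in> J" "w \<in> A" by (auto simp: add_mult_def)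
  then have "a * y = a * j + x * (a * w)" "a * j \<in> J" "a * w \<in> A"
    using \<open>a \<in> A\<close> is_subring_closed[OF assms(1)] ideal_in_closed[OF assms(2)]
    by (auto simp: algebra_simps)
  then show "a * y \<in> add_mult A J x" by (auto simp: add_mult_def)
qed

lemma add_mult_upper:
  assumes "is_subring A" "ideal_in A J"
  shows "J \<subseteq> add_mult A J x" "x \<in> add_mult A J x"
proof -
  show "J \<subseteq> add_mult A J x"
    using is_subring_closed(2)[OF assms(1)] by (force simp: add_mult_def)
  show "x \<in> add_mult A J x"
    using ideal_in_closed(1)[OF assms(2)] is_subring_closed(1)[OF assms(1)]
    by (force simp: add_mult_def)
qed

lemma add_mult_least:
  "ideal_in A I \<Longrightarrow> J \<subseteq> I \<Longrightarrow> x \<in> I \<Longrightarrow> add_mult A J x \<subseteq> I"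
  by (auto simp: add_mult_def intro!: ideal_in_closed(3,5))

lemma add_mult_commute: "add_mult A (add_mult A J x) z = add_mult A (add_mult A J z) x"
proof -
  have "add_mult A (add_mult A J x) z \<subseteq> add_mult A (add_mult A J z) x" for x z
  proof
    fix y assume "y \<in> add_mult A (add_mult A J x) z"
    then obtain j w w' where "y = (j + x * w) + z * w'" "j \<in> J" "w \<in> A" "w' \<in> A"
      by (auto simp: add_mult_def)
    then have "y = (j + z * w') + x * w" "j + z * w' \<in> add_mult A J z"
      by (auto simp: add_mult_def algebra_simps)
    then show "y \<in> add_mult A (add_mult A J z) x" using \<open>w \<in> A\<close> unfolding add_mult_def by blast
  qed
  then show ?thesis by blast
qed

subsection \<open>Noetherian rings\<close>

lemma noetherian_inD:
  assumes "noetherian_in A" "\<And>n. ideal_in A (I n)" "\<And>n. I n \<subseteq> I (Suc n)"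
  shows "\<exists>N. \<forall>n\<ge>N. I n = I N"
  using assms(1)[unfolded noetherian_in_def, rule_format, of I] assms(2,3) by simp

text \<open>Without a maximal member, dependent choice would build a strictly ascending chain inside
  \<open>F\<close>.\<close>

lemma noetherian_in_maximal:
  assumes "noetherian_in A" "F \<noteq> {}" "\<And>I. I \<in> F \<Longrightarrow> ideal_in A I"
  shows "\<exists>J\<in>F. \<forall>K\<in>F. J \<subseteq> K \<longrightarrow> K = J"
proof (rule ccontr)
  assume "\<not> ?thesis"
  then have *: "\<forall>J\<in>F. \<exists>K\<in>F. J \<subseteq> K \<and> K \<noteq> J" by simp
  have next_ideal: "\<exists>K. K \<in> F \<and> J \<subset> K" if J: "J \<in> F" for J
  proof -
    obtain K where "K \<in> F" "J \<subseteq> K" "K \<noteq> J" using bspec[OF * J] by (elim bexE conjE)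
    then show ?thesis by (intro exI[of _ K]) (simp add: psubset_eq)
  qed
  have "\<exists>f. \<forall>n. f n \<in> F \<and> f n \<subset> f (Suc n)"
  proof (rule dependent_nat_choice)
    show "\<exists>J. J \<in> F" using assms(2) by (simp add: ex_in_conv)
    show "\<exists>K. K \<in> F \<and> J \<subset> K" if "J \<in> F" for J using next_ideal[OF that] .
  qed
  then obtain f where f: "\<And>n. f n \<in> F" "\<And>n. f n \<subset> f (Suc n)" by metis
  have "\<And>n. ideal_in A (f n)" "\<And>n. f n \<subseteq> f (Suc n)"
    using f(1) assms(3) psubset_imp_subset[OF f(2)] by simp_all
  then obtain N where N: "\<And>n. N \<le> n \<Longrightarrow> f n = f N"
    using noetherian_inD[OF assms(1), of f] by metis
  have "f (Suc N) = f N" using N[of "Suc N"] by simp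
  then show False using f(2)[of N] by simp
qed

text \<open>A field has only two ideals: a nonzero element of some \<open>I N\<close> is a unit, so
  every later ideal is all of \<open>A\<close>. This starts the induction over generators with the
  field of constants.\<close>

lemma noetherian_in_field:
  assumes "is_subring A" and inv: "\<And>x. x \<in> A \<Longrightarrow> x \<noteq> 0 \<Longrightarrow> \<exists>y\<in>A. y * x = 1"
  shows "noetherian_in A"
  unfolding noetherian_in_def
proof (intro allI impI, elim conjE)
  fix I :: "nat \<Rightarrow> 'a set"
  assume I: "\<forall>n. ideal_in A (I n)" and inc: "\<forall>n. I n \<subseteq> I (Suc n)"
  have mono: "I m \<subseteq> I n" if "m \<le> n" for m n
    using lift_Suc_mono_le[of I, OF _ that] inc by blast
  show "\<exists>N. \<forall>n\<ge>N. I n = I N"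
  proof (cases "\<forall>n. I n \<subseteq> {0}")
    case True
    then have "I n = {0}" for n using I ideal_in_closed(1) by blast
    then show ?thesis by simp
  next
    case False
    then obtain N x where x: "x \<in> I N" "x \<noteq> 0" by blast
    have "I n = A" if "N \<le> n" for n
    proof -
      have idn: "ideal_in A (I n)" and xn: "x \<in> I n" using I x mono[OF that] by auto
      obtain y where "y \<in> A" "y * x = 1" using inv[of x] x idn ideal_in_closed(2) xn by blast
      then have "1 \<in> I n" using ideal_in_closed(4)[OF idn _ xn, of y] by simp
      then have "A \<subseteq> I n" using ideal_in_closed(4)[OF idn _ \<open>1 \<in> I n\<close>] by auto
      then show ?thesis using ideal_in_closed(2)[OF idn] by blast
    qed
    then show ?thesis by auto
  qed
qed

section \<open>Hilbert's basis theorem\<close>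

text \<open>The subring \<open>A[v]\<close>. Coefficient sequences take values in \<open>A\<close>
  at every index, also beyond \<open>n\<close>, so they can be added and scaled pointwise without
  tracking the degree.\<close>

definition adjoin :: "'r::comm_ring_1 set \<Rightarrow> 'r \<Rightarrow> 'r set" where
  "adjoin A v = {\<Sum>i<n. c i * v ^ i | n c. \<forall>i. c i \<in> A}"

lemma adjoin_memI: "(\<And>i. c i \<in> A) \<Longrightarrow> (\<Sum>i<n. c i * v ^ i) \<in> adjoin A v"
  by (auto simp: adjoin_def)

lemma
  assumes A: "is_subring A"
  shows is_subring_adjoin: "is_subring (adjoin A v)"
    and subset_adjoin: "A \<subseteq> adjoin A v"
    and self_adjoin: "v \<in> adjoin A v"
proof -
  note cl = is_subring_closed[OF A]
  show sub: "A \<subseteq> adjoin A v"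
  proof
    fix a assume "a \<in> A"
    then show "a \<in> adjoin A v"
      using adjoin_memI[of "\<lambda>i. a" A v 1] by simp
  qed
  have add: "x + y \<in> adjoin A v" if x: "x \<in> adjoin A v" and y: "y \<in> adjoin A v" for x y
  proof -
    obtain n c where c: "x = (\<Sum>i<n. c i * v ^ i)" "\<And>i. c i \<in> A" using x by (auto simp: adjoin_def)
    obtain m d where d: "y = (\<Sum>i<m. d i * v ^ i)" "\<And>i. d i \<in> A" using y by (auto simp: adjoin_def)
    let ?e = "\<lambda>i. (if i < n then c i else 0) + (if i < m then d i else 0)"
    have pad: "(\<Sum>i<k. f i * v ^ i) = (\<Sum>i<max n m. (if i < k then f i else 0) * v ^ i)"
      if "k \<le> max n m" for k f
      using that by (intro sum.mono_neutral_cong_left) auto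
    have "x + y = (\<Sum>i<max n m. ?e i * v ^ i)"
      unfolding c d pad[of n, OF max.cobounded1] pad[of m, OF max.cobounded2]
      by (simp add: sum.distrib ring_distribs)
    then show ?thesis using adjoin_memI[of ?e A v "max n m"] c d cl by (simp add: cl)
  qed
  have scale: "a * x \<in> adjoin A v" if a: "a \<in> A" and x: "x \<in> adjoin A v" for a x
  proof -
    obtain n c where c: "x = (\<Sum>i<n. c i * v ^ i)" "\<And>i. c i \<in> A" using x by (auto simp: adjoin_def)
    then have "a * x = (\<Sum>i<n. (a * c i) * v ^ i)" by (simp add: sum_distrib_left mult.assoc)
    then show ?thesis using adjoin_memI[of "\<lambda>i. a * c i" A v n] c a cl by simp
  qed
  have shift: "v * x \<in> adjoin A v" if x: "x \<in> adjoin A v" for x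
  proof -
    obtain n c where c: "x = (\<Sum>i<n. c i * v ^ i)" "\<And>i. c i \<in> A" using x by (auto simp: adjoin_def)
    let ?d = "\<lambda>i. case i of 0 \<Rightarrow> 0 | Suc j \<Rightarrow> c j"
    have "v * x = (\<Sum>i<Suc n. ?d i * v ^ i)"
      unfolding c sum.lessThan_Suc_shift by (simp add: sum_distrib_left algebra_simps)
    then show ?thesis using adjoin_memI[of ?d A v "Suc n"] c cl by (auto split: nat.split)
  qed
  have one: "1 \<in> adjoin A v" using sub cl by auto
  then show "v \<in> adjoin A v" using shift[OF one] by simp
  have zero: "0 \<in> adjoin A v" using sub cl by auto
  have power: "v ^ i * x \<in> adjoin A v" if "x \<in> adjoin A v" for x i
    using that by (induction i) (auto simp: mult.assoc intro: shift)
  have mult: "x * y \<in> adjoin A v" if x: "x \<in> adjoin A v" and y: "y \<in> adjoin A v" for x y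
  proof -
    obtain n c where c: "x = (\<Sum>i<n. c i * v ^ i)" "\<And>i. c i \<in> A" using x by (auto simp: adjoin_def)
    have "x * y = (\<Sum>i<n. c i * (v ^ i * y))" unfolding c by (simp add: sum_distrib_right mult.assoc)
    moreover have "(\<Sum>i<n. c i * (v ^ i * y)) \<in> adjoin A v" for n
      by (induction n) (auto intro!: zero add scale power y c)
    ultimately show ?thesis by simp
  qed
  have "x - y \<in> adjoin A v" if x: "x \<in> adjoin A v" and y: "y \<in> adjoin A v" for x y
    using add[OF x scale[of "-1", OF _ y]] cl by simp
  then show "is_subring (adjoin A v)" unfolding is_subring_def using one mult by blast
qed

lemma adjoin_least:
  assumes "is_subring B" "A \<subseteq> B" "v \<in> B"
  shows "adjoin A v \<subseteq> B"
  using assms unfolding adjoin_def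
  by (auto intro!: is_subring_sum is_subring_closed(5) is_subring_power)

text \<open>Hilbert's basis theorem, by comparing ideals through their ideals of leading coefficients
  \<open>L n I\<close> in each degree. No algebraic independence of \<open>v\<close> is needed.\<close>

lemma noetherian_in_adjoin:
  assumes A: "is_subring A" and noeth: "noetherian_in A"
  shows "noetherian_in (adjoin A v)"
proof -
  define B where "B = adjoin A v"
  note clA = is_subring_closed[OF A]
  have B: "is_subring B" and AB: "A \<subseteq> B" and vB: "v \<in> B"
    unfolding B_def using is_subring_adjoin subset_adjoin self_adjoin A by blast+
  \<comment> \<open>As \<open>v\<close> may be algebraic over \<open>A\<close>, an element can have
    several expressions; \<open>L n I\<close> collects the coefficient of \<open>v ^ n\<close> in
    any expression of degree at most \<open>n\<close>, zero included.\<close>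
  define L where "L n I = {a \<in> A. \<exists>c. (\<forall>i. c i \<in> A) \<and> a * v ^ n + (\<Sum>i<n. c i * v ^ i) \<in> I}"
    for n :: nat and I
  have L_ideal: "ideal_in A (L n I)" if I: "ideal_in B I" for n I
    unfolding ideal_in_def
  proof (intro conjI ballI)
    show "L n I \<subseteq> A" by (auto simp: L_def)
    show "0 \<in> L n I"
      unfolding L_def using clA ideal_in_closed[OF I] by (auto intro!: exI[of _ "\<lambda>_. 0"])
  next
    fix x y assume "x \<in> L n I" "y \<in> L n I"
    then obtain c d where *: "x \<in> A" "y \<in> A" "\<forall>i. c i \<in> A" "\<forall>i. d i \<in> A"
      "x * v ^ n + (\<Sum>i<n. c i * v ^ i) \<in> I" "y * v ^ n + (\<Sum>i<n. d i * v ^ i) \<in> I"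
      by (auto simp: L_def)
    have "(x + y) * v ^ n + (\<Sum>i<n. (c i + d i) * v ^ i) \<in> I"
      using ideal_in_closed(3)[OF I *(5,6)] by (simp add: sum.distrib ring_distribs algebra_simps)
    then show "x + y \<in> L n I"
      unfolding L_def using * clA by (auto intro!: exI[of _ "\<lambda>i. c i + d i"])
  next
    fix a x assume a: "a \<in> A" and "x \<in> L n I"
    then obtain c where *: "x \<in> A" "\<forall>i. c i \<in> A" "x * v ^ n + (\<Sum>i<n. c i * v ^ i) \<in> I"
      by (auto simp: L_def)
    have "(a * x) * v ^ n + (\<Sum>i<n. (a * c i) * v ^ i) \<in> I"
      using ideal_in_closed(4)[OF I _ *(3), of a] a AB
      by (auto simp: sum_distrib_left ring_distribs mult.assoc)
    then show "a * x \<in> L n I"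
      unfolding L_def using * clA a by (auto intro!: exI[of _ "\<lambda>i. a * c i"])
  qed
  have L_Suc: "L n I \<subseteq> L (Suc n) I" if I: "ideal_in B I" for n I
  proof
    fix x assume "x \<in> L n I"
    then obtain c where *: "x \<in> A" "\<forall>i. c i \<in> A" "x * v ^ n + (\<Sum>i<n. c i * v ^ i) \<in> I"
      by (auto simp: L_def)
    let ?d = "\<lambda>i. case i of 0 \<Rightarrow> 0 | Suc j \<Rightarrow> c j"
    have "v * (x * v ^ n + (\<Sum>i<n. c i * v ^ i)) = x * v ^ Suc n + (\<Sum>i<Suc n. ?d i * v ^ i)"
      unfolding sum.lessThan_Suc_shift by (simp add: sum_distrib_left algebra_simps)
    then have "x * v ^ Suc n + (\<Sum>i<Suc n. ?d i * v ^ i) \<in> I"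
      using ideal_in_closed(4)[OF I vB *(3)] by simp
    moreover have "\<forall>i. ?d i \<in> A" using * clA by (auto split: nat.split)
    ultimately show "x \<in> L (Suc n) I"
      unfolding L_def using *(1) by blast
  qed
  have L_le: "L m I \<subseteq> L n I" if "ideal_in B I" "m \<le> n" for m n I
    using lift_Suc_mono_le[of "\<lambda>n. L n I", OF L_Suc that(2)] that(1) by blast
  have L_mono: "L n I \<subseteq> L n J" if "I \<subseteq> J" for n I J using that by (auto simp: L_def)
  \<comment> \<open>Induction on degree: an element of \<open>J\<close> shares its leading
    coefficient with some element of \<open>I\<close> of the same degree, and the difference lies in
    \<open>J\<close> with smaller degree.\<close>
  have L_eq: "I = J" if I: "ideal_in B I" and J: "ideal_in B J" and "I \<subseteq> J"
    and LL: "\<And>n. L n J = L n I" for I J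
  proof -
    have "(\<forall>i. c i \<in> A) \<longrightarrow> (\<Sum>i<n. c i * v ^ i) \<in> J \<longrightarrow> (\<Sum>i<n. c i * v ^ i) \<in> I" for n c
    proof (induction n arbitrary: c)
      case 0 then show ?case using ideal_in_closed(1)[OF I] by simp
    next
      case (Suc n)
      show ?case
      proof (intro impI)
        assume c: "\<forall>i. c i \<in> A" and f: "(\<Sum>i<Suc n. c i * v ^ i) \<in> J"
        then have "c n \<in> L n J" unfolding L_def by (auto simp: add.commute)
        then obtain d where d: "\<forall>i. d i \<in> A" "c n * v ^ n + (\<Sum>i<n. d i * v ^ i) \<in> I"
          unfolding LL by (auto simp: L_def)
        have eq: "(\<Sum>i<n. (c i - d i) * v ^ i) =
            (\<Sum>i<Suc n. c i * v ^ i) - (c n * v ^ n + (\<Sum>i<n. d i * v ^ i))"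
          by (simp add: sum_subtractf ring_distribs)
        have "(\<Sum>i<n. (c i - d i) * v ^ i) \<in> J"
          unfolding eq using ideal_in_diff[OF B J f] d \<open>I \<subseteq> J\<close> by blast
        then have "(\<Sum>i<n. (c i - d i) * v ^ i) \<in> I"
          using Suc.IH[of "\<lambda>i. c i - d i"] c d clA by auto
        from ideal_in_closed(3)[OF I this d(2)] show "(\<Sum>i<Suc n. c i * v ^ i) \<in> I"
          unfolding eq by simp
      qed
    qed
    then have "f \<in> I" if "f \<in> J" for f
      using that ideal_in_closed(2)[OF J that] unfolding B_def adjoin_def by auto
    then show ?thesis using \<open>I \<subseteq> J\<close> by blast
  qed
  have "\<exists>N. \<forall>n\<ge>N. I n = I N"
    if I: "\<And>n. ideal_in B (I n)" and inc: "\<And>n. I n \<subseteq> I (Suc n)" for I :: "nat \<Rightarrow> 'a set"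
  proof -
    have mono: "I m \<subseteq> I n" if "m \<le> n" for m n
      using lift_Suc_mono_le[of I, OF inc that] .
    \<comment> \<open>\<open>L\<close> grows with the degree and with the ideal, so its diagonal is
      an ascending chain; where the diagonal stops, all large degrees stop at once.\<close>
    have "L k (I k) \<subseteq> L (Suc k) (I (Suc k))" for k
      by (rule order.trans[OF L_mono[OF inc] L_Suc[OF I]])
    from noetherian_inD[of A "\<lambda>k. L k (I k)", OF noeth L_ideal[OF I] this]
    obtain N0 where N0: "\<forall>k\<ge>N0. L k (I k) = L N0 (I N0)" ..
    have "\<exists>N. \<forall>k\<ge>N. L n (I k) = L n (I N)" for n
      by (rule noetherian_inD[of A "\<lambda>k. L n (I k)", OF noeth L_ideal[OF I] L_mono[OF inc]])
    then have "\<exists>N1. \<forall>n. \<forall>k\<ge>N1 n. L n (I k) = L n (I (N1 n))" by (intro choice allI)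
    then obtain N1 where N1: "\<forall>n. \<forall>k\<ge>N1 n. L n (I k) = L n (I (N1 n))" ..
    \<comment> \<open>Only the finitely many degrees below \<open>N0\<close> need a bound of their
      own.\<close>
    define N where "N = Max (insert N0 (N1 ` {..<N0}))"
    have N: "N0 \<le> N" "\<And>n. n < N0 \<Longrightarrow> N1 n \<le> N" unfolding N_def by auto
    have stable: "L n (I k) = L n (I N)" if "N \<le> k" for n k
    proof (cases "n < N0")
      case True
      then show ?thesis using N1[rule_format, of n k] N1[rule_format, of n N] N(2)[of n] that by simp
    next
      case False
      \<comment> \<open>\<open>L n (I j)\<close> is squeezed between \<open>L N0 (I N0)\<close> and
        the diagonal entry at \<open>max n j\<close>, which are equal.\<close>
      have *: "L n (I j) = L N0 (I N0)" if "N0 \<le> j" for j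
      proof
        have "L n (I j) \<subseteq> L (max n j) (I (max n j))"
          by (rule order.trans[OF L_le[OF I] L_mono[OF mono]]) auto
        then show "L n (I j) \<subseteq> L N0 (I N0)" using N0[rule_format, of "max n j"] that by simp
        show "L N0 (I N0) \<subseteq> L n (I j)"
          by (rule order.trans[OF L_le[OF I] L_mono[OF mono]]) (use that False in auto)
      qed
      show ?thesis using *[of k] *[of N] N(1) that by simp
    qed
    have "I k = I N" if "N \<le> k" for k
      by (rule L_eq[OF I I mono[OF that] stable[OF that], symmetric])
    then show ?thesis by (intro exI[of _ N] allI impI)
  qed
  then show ?thesis unfolding noetherian_in_def B_def[symmetric] by simp
qed

text \<open>One generator is adjoined at a time. Leastness of \<open>B\<close> is recorded so that
  \<open>B\<close> can later be identified with the image of a toric map.\<close>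

lemma noetherian_in_generated:
  assumes "is_subring K" "noetherian_in K" "finite Y"
  shows "\<exists>B. is_subring B \<and> noetherian_in B \<and> K \<union> Y \<subseteq> B \<and>
    (\<forall>T. is_subring T \<longrightarrow> K \<union> Y \<subseteq> T \<longrightarrow> B \<subseteq> T)"
  using assms(3)
proof (induction Y)
  case empty
  then show ?case using assms by (intro exI[of _ K]) auto
next
  case (insert v Y)
  then obtain B where B: "is_subring B" "noetherian_in B" "K \<union> Y \<subseteq> B"
    "\<And>T. is_subring T \<Longrightarrow> K \<union> Y \<subseteq> T \<Longrightarrow> B \<subseteq> T" by blast
  show ?case
  proof (intro exI[of _ "adjoin B v"] conjI allI impI)
    show "is_subring (adjoin B v)" "noetherian_in (adjoin B v)"
      using is_subring_adjoin noetherian_in_adjoin B by blast+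
    show "K \<union> insert v Y \<subseteq> adjoin B v"
      using subset_adjoin[OF B(1), of v] self_adjoin[OF B(1), of v] B(3) by blast
    show "adjoin B v \<subseteq> T" if "is_subring T" "K \<union> insert v Y \<subseteq> T" for T
      using that B(4)[of T] adjoin_least[of T B v] by blast
  qed
qed

section \<open>Associated primes and prime avoidance\<close>

lemma prime_in_prod:
  assumes "is_subring A" "prime_in A P" "\<And>i. i \<in> U \<Longrightarrow> f i \<in> A - P"
  shows "prod f U \<in> A - P"
  using assms(3)
proof (induction U rule: infinite_finite_induct)
  case (insert i U)
  then have "f i \<in> A - P" "prod f U \<in> A - P" by auto
  then show ?case
    using insert.hyps assms(1,2) by (auto simp: prime_in_def intro: is_subring_closed)
qed (use assms in \<open>auto simp: prime_in_def intro: is_subring_closed\<close>)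

lemma ideal_in_prod:
  assumes "is_subring A" "ideal_in A I" "finite U" "j \<in> U" "f j \<in> I" "\<And>i. i \<in> U \<Longrightarrow> f i \<in> A"
  shows "prod f U \<in> I"
  using ideal_in_closed(5)[OF assms(2) is_subring_prod[OF assms(1), of "U - {j}" f] assms(5)]
    assms(3,4,6) by (simp add: prod.remove)

text \<open>Otherwise each \<open>I w\<close> has an element outside \<open>P\<close>, and the
  product of these lies in every \<open>I w\<close>, hence in \<open>P\<close>, against primality.
  The elementwise form of the last hypothesis also makes sense for empty \<open>U\<close>, where the
  product is 1.\<close>

lemma prime_in_finite_Inter:
  assumes A: "is_subring A" and P: "prime_in A P" and "finite U"
    and I: "\<And>w. w \<in> U \<Longrightarrow> ideal_in A (I w)"
    and sub: "\<And>a. a \<in> A \<Longrightarrow> (\<And>w. w \<in> U \<Longrightarrow> a \<in> I w) \<Longrightarrow> a \<in> P"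
  shows "\<exists>w\<in>U. I w \<subseteq> P"
proof (rule ccontr)
  assume "\<not> ?thesis"
  then have "\<forall>w\<in>U. \<exists>x. x \<in> I w - P" by auto
  from bchoice[OF this] obtain f where f: "\<forall>w\<in>U. f w \<in> I w - P" ..
  have fA: "f w \<in> A - P" if "w \<in> U" for w using ideal_in_closed(2)[OF I[OF that]] f that by simp
  have "prod f U \<in> I w" if "w \<in> U" for w
    using ideal_in_prod[OF A I[OF that] \<open>finite U\<close> that, of f] that f fA by simp
  then have "prod f U \<in> P" using sub[of "prod f U"] prime_in_prod[OF A P, of U f] fA by simp
  then show False using prime_in_prod[OF A P, of U f] fA by simp
qed

text \<open>The ideal quotient \<open>(J : u)\<close>, that is, the annihilator of \<open>u\<close>
  modulo \<open>J\<close>.\<close>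

definition colon :: "'r::comm_ring_1 set \<Rightarrow> 'r set \<Rightarrow> 'r \<Rightarrow> 'r set" where
  "colon A J u = {a \<in> A. a * u \<in> J}"

lemma ideal_in_colon: "is_subring A \<Longrightarrow> ideal_in A J \<Longrightarrow> ideal_in A (colon A J u)"
  unfolding ideal_in_def colon_def
  by (auto simp: ring_distribs mult.assoc intro: is_subring_closed)

text \<open>The primes are the maximal annihilators of elements modulo \<open>J\<close>, i.e. maximal
  associated primes.\<close>

lemma zero_divisors_finite_primes:
  assumes A: "is_subring A" and noeth: "noetherian_in A" and J: "ideal_in A J"
  shows "\<exists>\<P>. finite \<P> \<and> (\<forall>P\<in>\<P>. prime_in A P \<and> (\<exists>u\<in>A - J. P = colon A J u)) \<and>
    (\<forall>x\<in>A - \<Union>\<P>. \<forall>r\<in>A. r * x \<in> J \<longrightarrow> r \<in> J)"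
proof -
  define F where "F = colon A J ` (A - J)"
  define \<P> where "\<P> = {P \<in> F. \<forall>Q\<in>F. P \<subseteq> Q \<longrightarrow> Q = P}"
  have F_ideal: "ideal_in A I" if "I \<in> F" for I
    using that ideal_in_colon[OF A J] by (auto simp: F_def)
  have above: "\<exists>P\<in>\<P>. I \<subseteq> P" if "I \<in> F" for I
  proof -
    have "\<exists>P\<in>{Q \<in> F. I \<subseteq> Q}. \<forall>K\<in>{Q \<in> F. I \<subseteq> Q}. P \<subseteq> K \<longrightarrow> K = P"
      by (rule noetherian_in_maximal[OF noeth]) (use that F_ideal in auto)
    then obtain P where P: "P \<in> F" "I \<subseteq> P"
      and max: "\<And>K. K \<in> F \<Longrightarrow> I \<subseteq> K \<Longrightarrow> P \<subseteq> K \<Longrightarrow> K = P" by auto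
    have "P \<in> \<P>"
      unfolding \<P>_def using P(1) max[OF _ order.trans[OF P(2)]] by simp
    then show ?thesis using P(2) ..
  qed
  have prime: "prime_in A P" if P: "P \<in> \<P>" for P
  proof -
    obtain u where u: "u \<in> A" "u \<notin> J" "P = colon A J u" using P by (auto simp: \<P>_def F_def)
    have "y \<in> P" if xy: "x \<in> A" "y \<in> A" "x * y \<in> P" "x \<notin> P" for x y
    proof -
      \<comment> \<open>Since \<open>x\<close> does not annihilate \<open>u\<close>, the product
        \<open>x * u\<close> has an annihilator in \<open>F\<close> too. It contains
        \<open>P\<close>, so it is \<open>P\<close> by maximality, and it contains
        \<open>y\<close>.\<close>
      have "x * u \<in> A - J" using xy u A by (auto simp: colon_def intro: is_subring_closed)
      then have "colon A J (x * u) \<in> F" by (auto simp: F_def)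
      moreover have "P \<subseteq> colon A J (x * u)"
        using u(3) ideal_in_closed(4)[OF J xy(1)] by (auto simp: colon_def mult.left_commute[of _ x])
      ultimately have "colon A J (x * u) = P" using P by (auto simp: \<P>_def)
      moreover have "y \<in> colon A J (x * u)"
        using xy u by (auto simp: colon_def ac_simps)
      ultimately show ?thesis by simp
    qed
    then show ?thesis
      using u ideal_in_colon[OF A J, of u] unfolding prime_in_def by (auto simp: colon_def)
  qed
  \<comment> \<open>Finiteness of the set of primes: \<open>K U\<close> consists of the elements
    killed modulo \<open>J\<close> by everything that kills \<open>U\<close>, and a finite
    \<open>U\<close> with \<open>K U\<close> maximal already sees all the primes.\<close>
  define M where "M = {u \<in> A - J. colon A J u \<in> \<P>}"
  define K where "K U = {x \<in> A. \<forall>a\<in>A. (\<forall>u\<in>U. a * u \<in> J) \<longrightarrow> a * x \<in> J}" for U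
  have "\<exists>L\<in>K ` {U. finite U \<and> U \<subseteq> M}. \<forall>L'\<in>K ` {U. finite U \<and> U \<subseteq> M}. L \<subseteq> L' \<longrightarrow> L' = L"
  proof (rule noetherian_in_maximal[OF noeth])
    have "K {} \<in> K ` {U. finite U \<and> U \<subseteq> M}" by blast
    then show "K ` {U. finite U \<and> U \<subseteq> M} \<noteq> {}" by blast
    have "ideal_in A (K U)" for U
      unfolding ideal_in_def K_def
      using is_subring_closed[OF A] ideal_in_closed[OF J]
      by (auto simp: ring_distribs mult.left_commute)
    then show "\<And>I. I \<in> K ` {U. finite U \<and> U \<subseteq> M} \<Longrightarrow> ideal_in A I" by blast
  qed
  then obtain U where U: "finite U" "U \<subseteq> M"
    and Umax: "\<And>V. finite V \<Longrightarrow> V \<subseteq> M \<Longrightarrow> K U \<subseteq> K V \<Longrightarrow> K V = K U" by auto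
  have "\<P> \<subseteq> colon A J ` U"
  proof
    fix P assume P: "P \<in> \<P>"
    then obtain u where u: "u \<in> A" "u \<notin> J" "P = colon A J u" by (auto simp: \<P>_def F_def)
    then have uM: "u \<in> M" using P by (auto simp: M_def)
    have "K (insert u U) = K U" using U uM by (intro Umax) (auto simp: K_def)
    moreover have "u \<in> K (insert u U)" using u by (auto simp: K_def)
    ultimately have uK: "u \<in> K U" by simp
    \<comment> \<open>\<open>u \<in> K U\<close> says that the common annihilator of
      \<open>U\<close> lies in \<open>P\<close>. Primality leaves a single annihilator below
      \<open>P\<close>, and its maximality turns the inclusion into equality.\<close>
    have "\<exists>w\<in>U. colon A J w \<subseteq> P"
    proof (rule prime_in_finite_Inter[OF A prime[OF P] U(1) ideal_in_colon[OF A J]])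
      fix a assume "a \<in> A" "\<And>w. w \<in> U \<Longrightarrow> a \<in> colon A J w"
      then show "a \<in> P" using uK u by (auto simp: K_def colon_def)
    qed
    then obtain w where w: "w \<in> U" "colon A J w \<subseteq> P" by blast
    then have "P = colon A J w" using U(2) P by (auto simp: M_def \<P>_def)
    then show "P \<in> colon A J ` U" using w(1) by blast
  qed
  then have "finite \<P>" using U(1) finite_subset by blast
  moreover have "prime_in A P \<and> (\<exists>u\<in>A - J. P = colon A J u)" if "P \<in> \<P>" for P
    using prime[OF that] that by (auto simp: \<P>_def F_def)
  moreover have "r \<in> J" if x: "x \<in> A - \<Union>\<P>" and r: "r \<in> A" "r * x \<in> J" for x r
  proof (rule ccontr)
    assume "r \<notin> J"
    then have "colon A J r \<in> F" using r by (auto simp: F_def)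
    moreover have "x \<in> colon A J r" using x r by (auto simp: colon_def mult.commute)
    ultimately show False using above x by blast
  qed
  ultimately show ?thesis by (intro exI[of _ \<P>]) simp
qed

text \<open>The primes belong to \<open>A\<close> while \<open>M\<close> is only an ideal of the
  subring \<open>S\<close>; this is what produces an element of the smaller ring that is generic for
  the larger one. As all the avoided ideals are prime, the field of constants may be finite.\<close>

lemma prime_avoidance:
  assumes A: "is_subring A" and S: "is_subring S" "S \<subseteq> A" and M: "ideal_in S M"
    and "finite \<P>" "\<And>P. P \<in> \<P> \<Longrightarrow> prime_in A P \<and> \<not> M \<subseteq> P"
  shows "\<exists>z\<in>M. z \<notin> \<Union>\<P>"
  using assms(5,6)
proof (induction "card \<P>" arbitrary: \<P> rule: less_induct)
  case less
  have MA: "M \<subseteq> S" "M \<subseteq> A" using M S by (auto simp: ideal_in_def)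
  show ?case
  proof (cases "\<P> = {}")
    case True
    then show ?thesis using ideal_in_closed(1)[OF M] by auto
  next
    case False
    then obtain P where P: "P \<in> \<P>" by blast
    have smaller: "card (\<P> - {Q}) < card \<P>" if "Q \<in> \<P>" for Q
      using card_Diff1_less[OF less.prems(1) that] .
    show ?thesis
    proof (cases "\<exists>Q\<in>\<P> - {P}. M \<inter> Q \<subseteq> P")
      case True
      then obtain Q where Q: "Q \<in> \<P>" "Q \<noteq> P" "M \<inter> Q \<subseteq> P" by blast
      have "\<exists>z\<in>M. z \<notin> \<Union>(\<P> - {Q})"
        by (rule less.hyps) (use smaller[OF Q(1)] less.prems in auto)
      then show ?thesis using Q P by blast
    next
      case False
      then have "\<forall>Q\<in>\<P> - {P}. \<exists>x. x \<in> M \<inter> Q - P" by blast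
      from bchoice[OF this] obtain f where f: "\<forall>Q\<in>\<P> - {P}. f Q \<in> M \<inter> Q - P" ..
      have "\<exists>z\<in>M. z \<notin> \<Union>(\<P> - {P})"
        by (rule less.hyps) (use smaller[OF P] less.prems in auto)
      then obtain x where x: "x \<in> M" "x \<notin> \<Union>(\<P> - {P})" by blast
      have primeP: "prime_in A P" "\<not> M \<subseteq> P" using less.prems(2)[OF P] by auto
      show ?thesis
      proof (cases "x \<in> P")
        case False
        then show ?thesis using x by blast
      next
        case xP: True
        \<comment> \<open>Here \<open>x\<close> lies in \<open>P\<close> and in no other prime of
          the family. Adding some \<open>y\<close> that lies in all the others but not in
          \<open>P\<close> avoids every one of them.\<close>
        have "\<exists>y\<in>M. y \<notin> P \<and> (\<forall>Q\<in>\<P> - {P}. y \<in> Q)"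
        proof (cases "\<P> - {P} = {}")
          case True
          then show ?thesis using primeP by blast
        next
          case False
          then obtain Q0 where Q0: "Q0 \<in> \<P> - {P}" by blast
          have fin: "finite (\<P> - {P})" using less.prems by simp
          have fS: "f Q \<in> S" "f Q \<in> A" "f Q \<in> M" "f Q \<in> Q" "f Q \<in> A - P" if "Q \<in> \<P> - {P}" for Q
            using bspec[OF f that] MA by auto
          have "prod f (\<P> - {P}) \<in> M"
            by (rule ideal_in_prod[OF S(1) M fin Q0]) (use fS Q0 in auto)
          moreover have "prod f (\<P> - {P}) \<in> Q" if "Q \<in> \<P> - {P}" for Q
            using ideal_in_prod[OF A _ fin that, of Q f] less.prems(2)[of Q] that fS
            by (auto simp: prime_in_def)
          moreover have "prod f (\<P> - {P}) \<notin> P"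
            using prime_in_prod[OF A primeP(1), of "\<P> - {P}" f] fS by blast
          ultimately show ?thesis by blast
        qed
        then obtain y where y: "y \<in> M" "y \<notin> P" "\<And>Q. Q \<in> \<P> - {P} \<Longrightarrow> y \<in> Q" by blast
        have "x + y \<notin> P"
          using ideal_in_diff[OF A _ _ xP, of "x + y"] primeP(1) y(2) by (auto simp: prime_in_def)
        moreover have "x + y \<notin> Q" if "Q \<in> \<P> - {P}" for Q
          using ideal_in_diff[OF A _ _ y(3)[OF that], of "x + y"] less.prems(2)[of Q] that x(2)
          by (auto simp: prime_in_def)
        ultimately show ?thesis using ideal_in_closed(3)[OF M x(1) y(1)] by blast
      qed
    qed
  qed
qed

subsection \<open>Regular sequences\<close>

text \<open>Regularity relative to a starting ideal, without the demand that the final ideal be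
  proper. The exchange therefore need not carry properness along; it is recovered once at the
  end.\<close>

primrec regular_mod :: "'r::comm_ring_1 set \<Rightarrow> 'r set \<Rightarrow> 'r list \<Rightarrow> bool" where
  "regular_mod A J [] \<longleftrightarrow> True"
| "regular_mod A J (x # xs) \<longleftrightarrow>
     (\<forall>r\<in>A. r * x \<in> J \<longrightarrow> r \<in> J) \<and> regular_mod A (add_mult A J x) xs"

text \<open>A generic \<open>z\<close> is regular modulo every ideal \<open>J + (t\<^sub>1, \<dots>, t\<^sub>i)\<close>, and can therefore replace
  the last term and be moved to the front.\<close>

lemma regular_mod_exchange_generic:
  assumes A: "is_subring A" and noeth: "noetherian_in A"
    and N: "N \<subseteq> A" "\<forall>P. prime_in A P \<longrightarrow> M \<subseteq> P \<longrightarrow> N \<subseteq> P"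
    and "ideal_in A J" "regular_mod A J ts" "ts \<noteq> []" "set ts \<subseteq> N"
  shows "\<exists>\<P>. finite \<P> \<and> (\<forall>P\<in>\<P>. prime_in A P \<and> \<not> M \<subseteq> P) \<and>
    (\<forall>z\<in>A - \<Union>\<P>. regular_mod A J (z # butlast ts))"
  using assms(5-)
proof (induction ts arbitrary: J)
  case Nil
  then show ?case by simp
next
  case (Cons t ts)
  note J = Cons.prems(1)
  have t: "t \<in> N" "t \<in> A" and t_reg: "\<And>r. r \<in> A \<Longrightarrow> r * t \<in> J \<Longrightarrow> r \<in> J"
    using Cons.prems N(1) by auto
  obtain \<P> where fin: "finite \<P>"
    and \<P>: "\<forall>P\<in>\<P>. prime_in A P \<and> (\<exists>u\<in>A - J. P = colon A J u)"
    and nzd: "\<forall>z\<in>A - \<Union>\<P>. \<forall>r\<in>A. r * z \<in> J \<longrightarrow> r \<in> J"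
    using zero_divisors_finite_primes[OF A noeth J] by (elim exE conjE)
  have \<P>': "prime_in A P \<and> \<not> M \<subseteq> P" if P: "P \<in> \<P>" for P
  proof -
    obtain u where u: "u \<in> A - J" "P = colon A J u" using bspec[OF \<P> P] by blast
    \<comment> \<open>\<open>P\<close> kills \<open>u\<close> modulo \<open>J\<close> and
      \<open>u \<notin> J\<close>, so the nonzerodivisor \<open>t\<close> is outside
      \<open>P\<close>. As \<open>t \<in> N\<close>, the hypothesis on primes then rules out
      \<open>M \<subseteq> P\<close>.\<close>
    have "t \<notin> P" using u t_reg[of u] by (auto simp: colon_def mult.commute)
    then show ?thesis using N(2)[rule_format, of P] t(1) bspec[OF \<P> P] by blast
  qed
  show ?case
  proof (cases "ts = []")
    case True
    then show ?thesis using fin \<P>' nzd by (intro exI[of _ \<P>]) auto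
  next
    case False
    have "\<exists>\<Q>. finite \<Q> \<and> (\<forall>P\<in>\<Q>. prime_in A P \<and> \<not> M \<subseteq> P) \<and>
        (\<forall>z\<in>A - \<Union>\<Q>. regular_mod A (add_mult A J t) (z # butlast ts))"
      using Cons.prems False by (intro Cons.IH ideal_in_add_mult[OF A J t(2)]) simp_all
    then obtain \<Q> where \<Q>: "finite \<Q>" "\<forall>P\<in>\<Q>. prime_in A P \<and> \<not> M \<subseteq> P"
      "\<forall>z\<in>A - \<Union>\<Q>. regular_mod A (add_mult A J t) (z # butlast ts)"
      by (elim exE conjE)
    have "regular_mod A J (z # butlast (t # ts))" if z: "z \<in> A - \<Union>(\<P> \<union> \<Q>)" for z
    proof -
      have zPQ: "z \<in> A - \<Union>\<P>" "z \<in> A - \<Union>\<Q>" using z by auto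
      have z1: "\<forall>r\<in>A. r * z \<in> J \<longrightarrow> r \<in> J" using bspec[OF nzd zPQ(1)] .
      have z2: "\<And>r. r \<in> A \<Longrightarrow> r * z \<in> add_mult A J t \<Longrightarrow> r \<in> add_mult A J t"
        and z3: "regular_mod A (add_mult A (add_mult A J z) t) (butlast ts)"
        using bspec[OF \<Q>(3) zPQ(2)] by (simp_all add: add_mult_commute[of A J t z])
      \<comment> \<open>Swapping neighbours: from \<open>r * t = j + z * w\<close>, regularity of
        \<open>z\<close> modulo \<open>J + (t)\<close> puts \<open>w\<close> into
        \<open>J + (t)\<close>. Then \<open>t\<close> divides out modulo \<open>J\<close>, and
        \<open>r\<close> differs from a multiple of \<open>z\<close> by an element of
        \<open>J\<close>.\<close>
      have "r \<in> add_mult A J z" if r: "r \<in> A" "r * t \<in> add_mult A J z" for r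
      proof -
        obtain j w where jw: "r * t = j + z * w" "j \<in> J" "w \<in> A" using r by (auto simp: add_mult_def)
        have "w * z = - j + t * r" using jw(1) by (simp add: algebra_simps)
        then have "w * z \<in> add_mult A J t"
          using ideal_in_uminus[OF A J jw(2)] r(1) unfolding add_mult_def by blast
        then obtain j' w' where jw': "w = j' + t * w'" "j' \<in> J" "w' \<in> A"
          using z2[OF jw(3)] by (auto simp: add_mult_def)
        have "(r - z * w') * t = j + z * j'" using jw(1) jw'(1) by (simp add: algebra_simps)
        moreover have "j + z * j' \<in> J" "r - z * w' \<in> A"
          using zPQ(1) ideal_in_closed(3)[OF J jw(2) ideal_in_closed(4)[OF J _ jw'(2), of z]]
            is_subring_closed(4)[OF A r(1) is_subring_closed(5)[OF A _ jw'(3), of z]] by simp_all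
        ultimately have "r - z * w' \<in> J" using t_reg by simp
        then have "(r - z * w') + z * w' \<in> add_mult A J z"
          using jw'(3) unfolding add_mult_def by blast
        then show ?thesis by simp
      qed
      then show ?thesis using z1 z3 False by simp
    qed
    moreover have "\<forall>P\<in>\<P> \<union> \<Q>. prime_in A P \<and> \<not> M \<subseteq> P" using \<Q>(2) \<P>' by blast
    moreover have "finite (\<P> \<union> \<Q>)" using fin \<Q>(1) by simp
    ultimately show ?thesis by (intro exI[of _ "\<P> \<union> \<Q>"] conjI ballI) auto
  qed
qed

text \<open>Prime avoidance supplies a generic \<open>z\<close> in \<open>M\<close>. It comes first
  in the new sequence, and the induction continues with \<open>butlast ts\<close> modulo
  \<open>J + (z)\<close>, so the length is preserved.\<close>

lemma regular_mod_exchange: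
  assumes A: "is_subring A" and noeth: "noetherian_in A"
    and S: "is_subring S" "S \<subseteq> A" and M: "ideal_in S M"
    and N: "N \<subseteq> A" "\<forall>P. prime_in A P \<longrightarrow> M \<subseteq> P \<longrightarrow> N \<subseteq> P"
    and "ideal_in A J" "regular_mod A J ts" "set ts \<subseteq> N"
  shows "\<exists>ss. length ss = length ts \<and> set ss \<subseteq> M \<and> regular_mod A J ss"
  using assms(8-)
proof (induction "length ts" arbitrary: J ts)
  case 0
  then show ?case by simp
next
  case (Suc n)
  then have "ts \<noteq> []" by auto
  obtain \<P> where fin: "finite \<P>" and primes: "\<forall>P\<in>\<P>. prime_in A P \<and> \<not> M \<subseteq> P"
    and \<P>: "\<forall>z\<in>A - \<Union>\<P>. regular_mod A J (z # butlast ts)"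
    using regular_mod_exchange_generic[of A N M J ts, OF A noeth N Suc.prems(1,2)
      \<open>ts \<noteq> []\<close> Suc.prems(3)]
    by (elim exE conjE)
  obtain z where z: "z \<in> M" "z \<notin> \<Union>\<P>"
    using prime_avoidance[OF A S M fin] primes by blast
  have zA: "z \<in> A" using ideal_in_closed(2)[OF M z(1)] S(2) by blast
  then have reg: "regular_mod A J (z # butlast ts)" using bspec[OF \<P>, of z] z(2) by simp
  have "\<exists>ss. length ss = length (butlast ts) \<and> set ss \<subseteq> M \<and> regular_mod A (add_mult A J z) ss"
  proof (rule Suc.hyps(1))
    show "n = length (butlast ts)" using Suc.hyps(2) by simp
    show "ideal_in A (add_mult A J z)" using ideal_in_add_mult[OF A Suc.prems(1) zA] .
    show "regular_mod A (add_mult A J z) (butlast ts)" using reg by simp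
    show "set (butlast ts) \<subseteq> N" using Suc.prems(3) by (meson in_set_butlastD subset_iff)
  qed
  then obtain ss where "length ss = length (butlast ts)" "set ss \<subseteq> M"
    "regular_mod A (add_mult A J z) ss" by blast
  then show ?case
    using reg z(1) Suc.hyps(2) by (intro exI[of _ "z # ss"]) auto
qed

subsection \<open>Subrings as ring structures\<close>

definition ring_on :: "'r::comm_ring_1 set \<Rightarrow> 'r ring" where
  "ring_on A = ring_of_type_algebra\<lparr>carrier := A\<rparr>"

lemma ring_on_simps [simp]:
  "carrier (ring_on A) = A" "x \<otimes>\<^bsub>ring_on A\<^esub> y = x * y" "x \<oplus>\<^bsub>ring_on A\<^esub> y = x + y"
  "\<one>\<^bsub>ring_on A\<^esub> = 1" "\<zero>\<^bsub>ring_on A\<^esub> = 0"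
  by (simp_all add: ring_on_def ring_of_type_algebra_def)

lemma cring_ring_on:
  assumes A: "is_subring A"
  shows "cring (ring_on A)"
proof (rule cringI)
  show "abelian_group (ring_on A)"
  proof (rule abelian_groupI)
    fix x assume "x \<in> carrier (ring_on A)"
    then show "\<exists>y\<in>carrier (ring_on A). y \<oplus>\<^bsub>ring_on A\<^esub> x = \<zero>\<^bsub>ring_on A\<^esub>"
      using is_subring_closed(3)[OF A] by (intro bexI[of _ "- x"]) auto
  qed (use is_subring_closed[OF A] in \<open>auto simp: algebra_simps\<close>)
  show "comm_monoid (ring_on A)"
    by (rule comm_monoidI) (use is_subring_closed[OF A] in \<open>auto simp: algebra_simps\<close>)
qed (auto simp: algebra_simps)

lemma ideal_ring_on_iff:
  assumes A: "is_subring A"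
  shows "ideal I (ring_on A) \<longleftrightarrow> ideal_in A I"
proof
  interpret R: cring "ring_on A" using cring_ring_on[OF A] .
  show "ideal_in A I" if "ideal I (ring_on A)"
  proof -
    interpret ideal I "ring_on A" using that .
    show ?thesis
      unfolding ideal_in_def using a_subset zero_closed a_closed I_l_closed by auto
  qed
  show "ideal I (ring_on A)" if I: "ideal_in A I"
  proof (rule idealI[OF R.ring_axioms])
    show "subgroup I (add_monoid (ring_on A))"
    proof (rule R.add.subgroupI)
      fix x assume x: "x \<in> I"
      have xA: "x \<in> A" using ideal_in_closed(2)[OF I x] .
      have "\<ominus>\<^bsub>ring_on A\<^esub> x = - x"
        using R.minus_equality[of "- x" x] xA is_subring_closed(3)[OF A xA] by simp
      then show "\<ominus>\<^bsub>ring_on A\<^esub> x \<in> I" using ideal_in_uminus[OF A I x] by simp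
    qed (use ideal_in_closed[OF I] in auto)
  qed (use ideal_in_closed[OF I] in auto)
qed

lemma ideal_in_proper_iff: "is_subring A \<Longrightarrow> ideal_in A I \<Longrightarrow> I \<noteq> A \<longleftrightarrow> 1 \<notin> I"
  using is_subring_closed(1)[of A] ideal_in_closed(2)[of A I] ideal_in_closed(4)[of A I _ 1] by auto

lemma primeideal_ring_on_iff:
  assumes A: "is_subring A"
  shows "primeideal P (ring_on A) \<longleftrightarrow> prime_in A P"
proof -
  interpret R: cring "ring_on A" using cring_ring_on[OF A] .
  have "A \<noteq> P \<longleftrightarrow> 1 \<notin> P" if "ideal_in A P"
    using ideal_in_proper_iff[OF A that] by auto
  then show ?thesis
    unfolding primeideal_def primeideal_axioms_def prime_in_def
    using ideal_ring_on_iff[OF A] R.cring_axioms by auto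
qed

lemma
  assumes A: "is_subring A" and Y: "Y \<subseteq> A"
  shows ideal_in_genideal: "ideal_in A (Idl\<^bsub>ring_on A\<^esub> Y)"
    and genideal_superset: "Y \<subseteq> Idl\<^bsub>ring_on A\<^esub> Y"
    and genideal_subset: "ideal_in A I \<Longrightarrow> Y \<subseteq> I \<Longrightarrow> Idl\<^bsub>ring_on A\<^esub> Y \<subseteq> I"
proof -
  interpret R: cring "ring_on A" using cring_ring_on[OF A] .
  show "ideal_in A (Idl\<^bsub>ring_on A\<^esub> Y)" "Y \<subseteq> Idl\<^bsub>ring_on A\<^esub> Y"
    using R.genideal_ideal[of Y] R.genideal_self[of Y] Y ideal_ring_on_iff[OF A] by auto
  show "ideal_in A I \<Longrightarrow> Y \<subseteq> I \<Longrightarrow> Idl\<^bsub>ring_on A\<^esub> Y \<subseteq> I"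
    using R.genideal_minimal[of I Y] ideal_ring_on_iff[OF A] by auto
qed

lemma genideal_insert:
  assumes A: "is_subring A" and J: "ideal_in A J" and x: "x \<in> A" and Y: "Y \<subseteq> A"
  shows "Idl\<^bsub>ring_on A\<^esub> (add_mult A J x \<union> Y) = Idl\<^bsub>ring_on A\<^esub> (J \<union> insert x Y)"
proof
  have JA: "J \<subseteq> A" and JxA: "add_mult A J x \<subseteq> A"
    using J ideal_in_add_mult[OF A J x] by (auto simp: ideal_in_def)
  note up = add_mult_upper[OF A J, of x]
  have l: "add_mult A J x \<union> Y \<subseteq> A" and r: "J \<union> insert x Y \<subseteq> A" using JA JxA Y x by auto
  show "Idl\<^bsub>ring_on A\<^esub> (add_mult A J x \<union> Y) \<subseteq> Idl\<^bsub>ring_on A\<^esub> (J \<union> insert x Y)"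
    using genideal_superset[OF A r] add_mult_least[OF ideal_in_genideal[OF A r], of J x]
    by (intro genideal_subset[OF A l ideal_in_genideal[OF A r]]) auto
  show "Idl\<^bsub>ring_on A\<^esub> (J \<union> insert x Y) \<subseteq> Idl\<^bsub>ring_on A\<^esub> (add_mult A J x \<union> Y)"
    using genideal_superset[OF A l] up
    by (intro genideal_subset[OF A r ideal_in_genideal[OF A l]]) auto
qed

lemma genideal_ideal_in: "is_subring A \<Longrightarrow> ideal_in A J \<Longrightarrow> Idl\<^bsub>ring_on A\<^esub> J = J"
  using genideal_subset[of A J J] genideal_superset[of A J] by (auto simp: ideal_in_def)

text \<open>Links the recursive form to the prefixes used in \<open>regular_sequence\<close>. The
  starting ideal stays arbitrary because each recursion step enlarges it.\<close>

lemma regular_mod_iff: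
  assumes A: "is_subring A" and "ideal_in A J" "set xs \<subseteq> A"
  shows "regular_mod A J xs \<longleftrightarrow> (\<forall>i<length xs. \<forall>r\<in>A.
    r * (xs ! i) \<in> Idl\<^bsub>ring_on A\<^esub> (J \<union> set (take i xs)) \<longrightarrow>
    r \<in> Idl\<^bsub>ring_on A\<^esub> (J \<union> set (take i xs)))"
  using assms(2,3)
proof (induction xs arbitrary: J)
  case Nil
  then show ?case by simp
next
  case (Cons x xs)
  have x: "x \<in> A" using Cons.prems by simp
  have "set (take i xs) \<subseteq> A" for i using Cons.prems(2) set_take_subset[of i xs] by auto
  then have "Idl\<^bsub>ring_on A\<^esub> (add_mult A J x \<union> set (take i xs)) =
      Idl\<^bsub>ring_on A\<^esub> (J \<union> insert x (set (take i xs)))" for i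
    using genideal_insert[OF A Cons.prems(1) x] by blast
  then show ?case
    using Cons.IH[OF ideal_in_add_mult[OF A Cons.prems(1) x]] Cons.prems
    by (simp add: All_less_Suc2 genideal_ideal_in[OF A])
qed

lemma regular_sequence_ring_on_iff:
  assumes A: "is_subring A"
  shows "regular_sequence (ring_on A) xs \<longleftrightarrow>
    set xs \<subseteq> A \<and> regular_mod A {0} xs \<and> Idl\<^bsub>ring_on A\<^esub> (set xs) \<noteq> A"
proof (cases "set xs \<subseteq> A")
  case True
  have "Idl\<^bsub>ring_on A\<^esub> ({0} \<union> Y) = Idl\<^bsub>ring_on A\<^esub> Y" if Y: "Y \<subseteq> A" for Y
  proof -
    have l: "{0} \<union> Y \<subseteq> A" using Y is_subring_closed(2)[OF A] by simp
    show ?thesis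
      using genideal_subset[OF A l ideal_in_genideal[OF A Y]] genideal_superset[OF A Y]
        ideal_in_closed(1)[OF ideal_in_genideal[OF A Y]]
        genideal_subset[OF A Y ideal_in_genideal[OF A l]] genideal_superset[OF A l] by auto
  qed
  moreover have "set (take i xs) \<subseteq> A" for i using True set_take_subset[of i xs] by auto
  ultimately have "Idl\<^bsub>ring_on A\<^esub> ({0} \<union> set (take i xs)) = Idl\<^bsub>ring_on A\<^esub> (set (take i xs))" for i
    by blast
  then show ?thesis
    using True regular_mod_iff[OF A ideal_in_zero[OF A] True]
    unfolding regular_sequence_def by simp
qed (auto simp: regular_sequence_def)

subsection \<open>Free extensions of finite rank\<close>

text \<open>More vectors than coordinates are dependent over the fraction field of
  \<open>S/p\<close>. Cleared of denominators, this is Gaussian elimination with pivots outside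
  \<open>p\<close>.\<close>

lemma linear_dependence_mod_prime:
  assumes S: "is_subring S" and p: "prime_in S p"
    and "finite K" "finite I" "card K < card I" "\<And>i k. i \<in> I \<Longrightarrow> k \<in> K \<Longrightarrow> v i k \<in> S"
  shows "\<exists>c. (\<forall>i\<in>I. c i \<in> S) \<and> (\<exists>i\<in>I. c i \<notin> p) \<and> (\<forall>k\<in>K. (\<Sum>i\<in>I. c i * v i k) \<in> p)"
  using assms(3-)
proof (induction K arbitrary: I v rule: finite_induct)
  case empty
  then obtain i where "i \<in> I" by (metis card_gt_0_iff card.empty ex_in_conv)
  then show ?case
    using p is_subring_closed(1)[OF S] by (intro exI[of _ "\<lambda>_. 1"]) (auto simp: prime_in_def)
next
  case (insert k K)
  note cl = is_subring_closed[OF S]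
  have pid: "ideal_in S p" using p by (simp add: prime_in_def)
  show ?case
  proof (cases "\<forall>i\<in>I. v i k \<in> p")
    case True
    have "\<exists>c. (\<forall>i\<in>I. c i \<in> S) \<and> (\<exists>i\<in>I. c i \<notin> p) \<and> (\<forall>k\<in>K. (\<Sum>i\<in>I. c i * v i k) \<in> p)"
      using insert by (intro insert.IH) auto
    then obtain c where c: "\<forall>i\<in>I. c i \<in> S" "\<exists>i\<in>I. c i \<notin> p" "\<forall>k\<in>K. (\<Sum>i\<in>I. c i * v i k) \<in> p"
      by (elim exE conjE)
    have "(\<Sum>i\<in>I. c i * v i k) \<in> p"
      using c(1) True by (intro ideal_in_sum[OF pid] ideal_in_closed(4)[OF pid]) auto
    then show ?thesis using c by (intro exI[of _ c]) simp
  next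
    case False
    then obtain i0 where i0: "i0 \<in> I" "v i0 k \<notin> p" by blast
    define I' where "I' = I - {i0}"
    \<comment> \<open>Cross-multiplication with the pivot \<open>v i0 k\<close> eliminates
      coordinate \<open>k\<close> without division.\<close>
    define w where "w i l = v i0 k * v i l - v i k * v i0 l" for i l
    have vS: "v i l \<in> S" if "i \<in> I" "l \<in> insert k K" for i l using insert.prems(3) that by blast
    have "\<exists>c. (\<forall>i\<in>I'. c i \<in> S) \<and> (\<exists>i\<in>I'. c i \<notin> p) \<and> (\<forall>k\<in>K. (\<Sum>i\<in>I'. c i * w i k) \<in> p)"
    proof (rule insert.IH)
      show "finite I'" "card K < card I'" using insert i0(1) by (auto simp: I'_def)
      show "w i l \<in> S" if "i \<in> I'" "l \<in> K" for i l
        unfolding w_def using that i0(1) by (intro cl(4,5) vS) (auto simp: I'_def)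
    qed
    then obtain c where c: "\<forall>i\<in>I'. c i \<in> S" "\<exists>i\<in>I'. c i \<notin> p" "\<forall>k\<in>K. (\<Sum>i\<in>I'. c i * w i k) \<in> p"
      by (elim exE conjE)
    \<comment> \<open>The coefficient at \<open>i0\<close> undoes the elimination; the others remain
      outside \<open>p\<close> when \<open>c i\<close> does, because the pivot is outside the prime
      \<open>p\<close>.\<close>
    define d where "d i = (if i = i0 then - (\<Sum>j\<in>I'. c j * v j k) else v i0 k * c i)" for i
    have dI': "d i = v i0 k * c i" if "i \<in> I'" for i using that by (auto simp: d_def I'_def)
    have I'_sub: "i \<in> I" if "i \<in> I'" for i using that by (simp add: I'_def)
    have sum_d: "(\<Sum>i\<in>I. d i * v i l) = (\<Sum>i\<in>I'. c i * w i l)" for l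
    proof -
      have "(\<Sum>i\<in>I. d i * v i l) = d i0 * v i0 l + (\<Sum>i\<in>I'. d i * v i l)"
        unfolding I'_def by (rule sum.remove[OF insert.prems(1) i0(1)])
      also have "(\<Sum>i\<in>I'. d i * v i l) = (\<Sum>i\<in>I'. v i0 k * c i * v i l)"
        by (intro sum.cong) (auto simp: dI')
      also have "d i0 * v i0 l = (\<Sum>j\<in>I'. - (c j * v j k * v i0 l))"
        by (simp add: d_def sum_distrib_right sum_negf)
      finally show ?thesis
        by (simp add: sum.distrib[symmetric] w_def algebra_simps)
    qed
    have "\<forall>i\<in>I. d i \<in> S"
    proof
      fix i assume i: "i \<in> I"
      have "(\<Sum>j\<in>I'. c j * v j k) \<in> S"
        using c(1) I'_sub by (intro is_subring_sum[OF S] cl(5) vS) auto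
      then show "d i \<in> S"
        using c(1) i i0(1) vS[of i0 k] cl by (auto simp: d_def I'_def)
    qed
    moreover have "\<exists>i\<in>I. d i \<notin> p"
    proof -
      obtain i where i: "i \<in> I'" "c i \<notin> p" using c(2) by blast
      then have "d i \<notin> p"
        using p c(1) i0 vS[of i0 k] unfolding dI'[OF i(1)] prime_in_def by blast
      then show ?thesis using I'_sub[OF i(1)] by blast
    qed
    moreover have "\<forall>l\<in>insert k K. (\<Sum>i\<in>I. d i * v i l) \<in> p"
    proof
      fix l assume l: "l \<in> insert k K"
      have "(\<Sum>i\<in>I'. c i * w i k) = 0" by (simp add: w_def mult.commute)
      then show "(\<Sum>i\<in>I. d i * v i l) \<in> p"
        unfolding sum_d using c(3) l ideal_in_closed(1)[OF pid] by auto
    qed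
    ultimately show ?thesis by (intro exI[of _ d]) simp
  qed
qed

text \<open>Having 1 in the basis makes \<open>S\<close> a direct summand of \<open>T\<close>, so
  extending an ideal of \<open>S\<close> to \<open>T\<close> and contracting it again gives the same
  ideal.\<close>

locale free_extension =
  fixes S T :: "'r::comm_ring_1 set" and E :: "'i set" and e :: "'i \<Rightarrow> 'r" and i0 :: 'i
  assumes S: "is_subring S" and T: "is_subring T" and S_subset_T: "S \<subseteq> T"
    and finite_basis: "finite E" and basis_mem: "\<And>i. i \<in> E \<Longrightarrow> e i \<in> T"
    and one_basis: "i0 \<in> E" "e i0 = 1"
    and span: "\<And>t. t \<in> T \<Longrightarrow> \<exists>s. (\<forall>i\<in>E. s i \<in> S) \<and> t = (\<Sum>i\<in>E. s i * e i)"
    and independent: "\<And>s. \<forall>i\<in>E. s i \<in> S \<Longrightarrow> (\<Sum>i\<in>E. s i * e i) = 0 \<Longrightarrow> \<forall>i\<in>E. s i = 0"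
begin

text \<open>For an ideal \<open>I\<close> of \<open>S\<close> this is the extended ideal
  \<open>I T\<close>, written by coordinates so that membership can be tested
  coordinatewise.\<close>

definition ext :: "'r set \<Rightarrow> 'r set" where
  "ext I = {\<Sum>i\<in>E. s i * e i | s. \<forall>i\<in>E. s i \<in> I}"

lemma basis_sum_mem_ext_iff:
  assumes "I \<subseteq> S" "\<forall>i\<in>E. s i \<in> S"
  shows "(\<Sum>i\<in>E. s i * e i) \<in> ext I \<longleftrightarrow> (\<forall>i\<in>E. s i \<in> I)"
proof
  assume "(\<Sum>i\<in>E. s i * e i) \<in> ext I"
  then obtain r where r: "(\<Sum>i\<in>E. s i * e i) = (\<Sum>i\<in>E. r i * e i)" "\<forall>i\<in>E. r i \<in> I"
    unfolding ext_def by auto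
  have "\<forall>i\<in>E. s i - r i = 0"
  proof (rule independent)
    show "\<forall>i\<in>E. s i - r i \<in> S" using assms r(2) is_subring_closed(4)[OF S] by auto
    show "(\<Sum>i\<in>E. (s i - r i) * e i) = 0" using r(1) by (simp add: left_diff_distrib sum_subtractf)
  qed
  then show "\<forall>i\<in>E. s i \<in> I" using r(2) by auto
qed (auto simp: ext_def)

lemma mem_ext_iff:
  assumes "I \<subseteq> S" "0 \<in> I" "s \<in> S"
  shows "s \<in> ext I \<longleftrightarrow> s \<in> I"
proof -
  define f where "f i = (if i = i0 then s else 0)" for i
  have "(\<Sum>i\<in>E. f i * e i) = (\<Sum>i\<in>E. if i = i0 then s else 0)"
    using one_basis by (intro sum.cong) (auto simp: f_def)
  also have "\<dots> = s" using one_basis finite_basis by simp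
  finally have "s = (\<Sum>i\<in>E. f i * e i)" ..
  moreover have "\<forall>i\<in>E. f i \<in> S" using assms by (auto simp: f_def)
  moreover have "(\<forall>i\<in>E. f i \<in> I) \<longleftrightarrow> s \<in> I" using assms(2) one_basis(1) by (auto simp: f_def)
  ultimately show ?thesis using basis_sum_mem_ext_iff[OF assms(1), of f] by simp
qed

lemma ideal_in_ext:
  assumes I: "ideal_in S I"
  shows "ideal_in T (ext I)"
  unfolding ideal_in_def
proof (intro conjI ballI)
  have IS: "I \<subseteq> S" using I by (simp add: ideal_in_def)
  show "ext I \<subseteq> T"
    using IS S_subset_T basis_mem
    by (auto simp: ext_def intro!: is_subring_sum[OF T] is_subring_closed(5)[OF T])
  show "0 \<in> ext I"
    using ideal_in_closed(1)[OF I] by (auto simp: ext_def intro!: exI[of _ "\<lambda>_. 0"])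
next
  fix x y assume "x \<in> ext I" "y \<in> ext I"
  then obtain r s where "x = (\<Sum>i\<in>E. r i * e i)" "y = (\<Sum>i\<in>E. s i * e i)"
    "\<forall>i\<in>E. r i \<in> I" "\<forall>i\<in>E. s i \<in> I"
    by (auto simp: ext_def)
  then have "x + y = (\<Sum>i\<in>E. (r i + s i) * e i)" "\<forall>i\<in>E. r i + s i \<in> I"
    using ideal_in_closed(3)[OF I] by (auto simp: sum.distrib ring_distribs)
  then show "x + y \<in> ext I" unfolding ext_def by (intro CollectI exI conjI)
next
  fix t x assume t: "t \<in> T" and "x \<in> ext I"
  then obtain s where s: "x = (\<Sum>i\<in>E. s i * e i)" "\<forall>i\<in>E. s i \<in> I"
    by (auto simp: ext_def)
  \<comment> \<open>\<open>d\<close> is the matrix of multiplication by \<open>t\<close>; it has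
    entries in \<open>S\<close>, so it maps coordinate vectors over \<open>I\<close> to such
    vectors.\<close>
  have "\<forall>i\<in>E. \<exists>d. (\<forall>k\<in>E. d k \<in> S) \<and> t * e i = (\<Sum>k\<in>E. d k * e k)"
    using span is_subring_closed(5)[OF T t basis_mem] by simp
  from bchoice[OF this] obtain d
    where d: "\<forall>i\<in>E. (\<forall>k\<in>E. d i k \<in> S) \<and> t * e i = (\<Sum>k\<in>E. d i k * e k)" ..
  have "t * x = (\<Sum>i\<in>E. s i * (t * e i))"
    unfolding s by (simp add: sum_distrib_left mult.left_commute)
  also have "\<dots> = (\<Sum>i\<in>E. s i * (\<Sum>k\<in>E. d i k * e k))"
    using d by (intro sum.cong) auto
  also have "\<dots> = (\<Sum>i\<in>E. \<Sum>k\<in>E. s i * d i k * e k)" by (simp add: sum_distrib_left mult.assoc)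
  also have "\<dots> = (\<Sum>k\<in>E. (\<Sum>i\<in>E. s i * d i k) * e k)"
    unfolding sum_distrib_right by (rule sum.swap)
  finally have eq: "t * x = (\<Sum>k\<in>E. (\<Sum>i\<in>E. s i * d i k) * e k)" .
  have "\<forall>k\<in>E. (\<Sum>i\<in>E. s i * d i k) \<in> I"
    using s(2) d by (auto intro!: ideal_in_sum[OF I] ideal_in_closed(5)[OF I])
  then show "t * x \<in> ext I"
    unfolding ext_def eq by (intro CollectI exI[of _ "\<lambda>k. \<Sum>i\<in>E. s i * d i k"] conjI refl)
qed

lemma ext_subset:
  assumes "ideal_in T J" "I \<subseteq> J"
  shows "ext I \<subseteq> J"
  using assms basis_mem
  by (auto simp: ext_def intro!: ideal_in_sum[of T J] ideal_in_closed(5)[of T J])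

text \<open>Elements of \<open>S\<close> multiply coordinatewise, so a nonzerodivisor modulo
  \<open>I\<close> stays one modulo \<open>I T\<close>. This is the form in which flatness is
  used.\<close>

lemma mult_mem_ext_cancel:
  assumes I: "ideal_in S I" and s: "s \<in> S" and t: "t \<in> T" "t * s \<in> ext I"
    and cancel: "\<forall>r\<in>S. r * s \<in> I \<longrightarrow> r \<in> I"
  shows "t \<in> ext I"
proof -
  have IS: "I \<subseteq> S" using I by (simp add: ideal_in_def)
  obtain r where r: "\<forall>i\<in>E. r i \<in> S" "t = (\<Sum>i\<in>E. r i * e i)" using span[OF t(1)] by (elim exE conjE)
  have "t * s = (\<Sum>i\<in>E. (r i * s) * e i)"
    unfolding r by (simp add: sum_distrib_left sum_distrib_right ac_simps)
  moreover have rs: "\<forall>i\<in>E. r i * s \<in> S" using r(1) s is_subring_closed(5)[OF S] by simp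
  ultimately have "\<forall>i\<in>E. r i * s \<in> I" using basis_sum_mem_ext_iff[OF IS rs] t(2) by simp
  then show ?thesis
    unfolding r using basis_sum_mem_ext_iff[OF IS r(1)] r(1) cancel by simp
qed

section \<open>Going down and incomparability\<close>

text \<open>With \<open>U = {1}\<close> this is lying over, and with \<open>U = T - Q\<close> for a prime \<open>Q\<close> it is going down.\<close>

lemma prime_over:
  assumes noeth: "noetherian_in T" and p: "prime_in S p"
    and U: "U \<subseteq> T" "1 \<in> U" "\<forall>u\<in>U. \<forall>v\<in>U. u * v \<in> U" "U \<inter> ext p = {}"
  shows "\<exists>P. prime_in T P \<and> P \<inter> S = p \<and> P \<inter> U = {}"
proof -
  have pid: "ideal_in S p" and p1: "1 \<notin> p" and pS: "p \<subseteq> S"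
    using p by (simp_all add: prime_in_def ideal_in_def)
  \<comment> \<open>The prime is a maximal ideal among those that contain \<open>p T\<close> and
    avoid all products \<open>s * u\<close>. Since 1 lies in both factors, avoiding them yields
    contraction \<open>p\<close> and disjointness from \<open>U\<close>.\<close>
  define F where "F = {J. ideal_in T J \<and> ext p \<subseteq> J \<and> (\<forall>s\<in>S - p. \<forall>u\<in>U. s * u \<notin> J)}"
  have "s * u \<notin> ext p" if s: "s \<in> S - p" and u: "u \<in> U" for s u
  proof
    assume "s * u \<in> ext p"
    then have "u \<in> ext p"
      using mult_mem_ext_cancel[OF pid, of s u] s u U(1) p
      by (auto simp: mult.commute prime_in_def)
    then show False using u U(4) by blast
  qed
  then have "ext p \<in> F" unfolding F_def using ideal_in_ext[OF pid] by simp
  then have "\<exists>J\<in>F. \<forall>K\<in>F. J \<subseteq> K \<longrightarrow> K = J"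
    by (intro noetherian_in_maximal[OF noeth]) (auto simp: F_def)
  then obtain J where J: "J \<in> F" and max: "\<forall>K\<in>F. J \<subseteq> K \<longrightarrow> K = J" ..
  have Jid: "ideal_in T J" and Jp: "ext p \<subseteq> J" and JU: "\<forall>s\<in>S - p. \<forall>u\<in>U. s * u \<notin> J"
    using J by (simp_all add: F_def)
  have S1: "1 \<in> S - p" using is_subring_closed(1)[OF S] p1 by simp
  \<comment> \<open>By maximality, adding any \<open>x\<close> outside \<open>J\<close> produces a
    forbidden product.\<close>
  have enlarge: "\<exists>s\<in>S - p. \<exists>u\<in>U. \<exists>w\<in>T. s * u - x * w \<in> J" if x: "x \<in> T" "x \<notin> J" for x
  proof (rule ccontr)
    assume neg: "\<not> ?thesis"
    note up = add_mult_upper[OF T Jid, of x]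
    have "add_mult T J x \<in> F"
      unfolding F_def
    proof (intro CollectI conjI ballI)
      show "ideal_in T (add_mult T J x)" using ideal_in_add_mult[OF T Jid x(1)] .
      show "ext p \<subseteq> add_mult T J x" using Jp up(1) by simp
      fix s u assume su: "s \<in> S - p" "u \<in> U"
      show "s * u \<notin> add_mult T J x"
      proof
        assume "s * u \<in> add_mult T J x"
        then obtain j w where "s * u = j + x * w" "j \<in> J" "w \<in> T" unfolding add_mult_def by blast
        then have "s * u - x * w \<in> J" by simp
        then show False using neg su \<open>w \<in> T\<close> by blast
      qed
    qed
    then have "add_mult T J x = J" using max up(1) by simp
    then show False using up(2) x(2) by simp
  qed
  have "prime_in T J"
    unfolding prime_in_def
  proof (intro conjI ballI impI Jid)
    show "1 \<notin> J" using JU S1 U(2) by force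
    fix x y assume xy: "x \<in> T" "y \<in> T" "x * y \<in> J"
    show "x \<in> J \<or> y \<in> J"
    proof (rule ccontr)
      assume "\<not> ?thesis"
      then obtain s u w s' u' w' where *: "s \<in> S - p" "u \<in> U" "w \<in> T" "s * u - x * w \<in> J"
        "s' \<in> S - p" "u' \<in> U" "w' \<in> T" "s' * u' - y * w' \<in> J"
        using enlarge[of x] enlarge[of y] xy by metis
      have mem: "s' * u' \<in> T" "x * w \<in> T"
        using * S_subset_T U(1) xy(1) is_subring_closed(5)[OF T] by auto
      \<comment> \<open>Modulo \<open>J\<close> the two forbidden products equal
        \<open>x * w\<close> and \<open>y * w'\<close>; their product is then a multiple of
        \<open>x * y\<close>, so a forbidden product would lie in \<open>J\<close>.\<close>
      have "(s * s') * (u * u') =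
          (s * u - x * w) * (s' * u') + (x * w) * (s' * u' - y * w') + (w * w') * (x * y)"
        by (simp add: algebra_simps)
      moreover have "(s * u - x * w) * (s' * u') \<in> J" "(x * w) * (s' * u' - y * w') \<in> J"
        "(w * w') * (x * y) \<in> J"
        using ideal_in_closed(4,5)[OF Jid] mem * xy is_subring_closed(5)[OF T] by auto
      ultimately have "(s * s') * (u * u') \<in> J" using ideal_in_closed(3)[OF Jid] by simp
      moreover have "s * s' \<in> S - p"
        using *(1,5) p is_subring_closed(5)[OF S] by (auto simp: prime_in_def)
      moreover have "u * u' \<in> U" using U(3) * by blast
      ultimately show False using JU by blast
    qed
  qed
  moreover have "J \<inter> S = p"
  proof
    show "J \<inter> S \<subseteq> p" using JU U(2) by force
    have "p \<subseteq> ext p" using mem_ext_iff[OF pS ideal_in_closed(1)[OF pid]] pS by auto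
    then show "p \<subseteq> J \<inter> S" using Jp pS by blast
  qed
  moreover have "J \<inter> U = {}" using JU S1 by force
  ultimately show ?thesis by blast
qed

text \<open>The chain is indexed from its largest member, since going down can only continue below a
  prime already lifted; lying over starts it.\<close>

lemma lift_prime_chain:
  assumes noeth: "noetherian_in T"
    and "\<forall>k\<le>n. prime_in S (q k)" "\<forall>k<n. q (Suc k) \<subseteq> q k"
  shows "\<exists>Q. (\<forall>k\<le>n. prime_in T (Q k) \<and> Q k \<inter> S = q k) \<and> (\<forall>k<n. Q (Suc k) \<subseteq> Q k)"
  using assms(2,3)
proof (induction n)
  case 0
  then have q: "prime_in S (q 0)" by simp
  have "1 \<notin> ext (q 0)"
    using q mem_ext_iff[of "q 0" 1] is_subring_closed(1)[OF S] by (auto simp: prime_in_def ideal_in_def)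
  then obtain P where "prime_in T P" "P \<inter> S = q 0"
    using prime_over[OF noeth q, of "{1}"] is_subring_closed(1)[OF T] by auto
  then show ?case by (intro exI[of _ "\<lambda>_. P"]) simp
next
  case (Suc n)
  have "\<exists>Q. (\<forall>k\<le>n. prime_in T (Q k) \<and> Q k \<inter> S = q k) \<and> (\<forall>k<n. Q (Suc k) \<subseteq> Q k)"
    using Suc.prems by (intro Suc.IH) auto
  then obtain Q where Q: "\<forall>k\<le>n. prime_in T (Q k) \<and> Q k \<inter> S = q k" "\<forall>k<n. Q (Suc k) \<subseteq> Q k"
    by (elim exE conjE)
  have Qn: "prime_in T (Q n)" "Q n \<inter> S = q n" using Q(1) by auto
  have sub: "ext (q (Suc n)) \<subseteq> Q n"
    using Suc.prems(2) Qn by (intro ext_subset) (auto simp: prime_in_def)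
  have "\<exists>P. prime_in T P \<and> P \<inter> S = q (Suc n) \<and> P \<inter> (T - Q n) = {}"
  proof (rule prime_over[OF noeth])
    show "prime_in S (q (Suc n))" using Suc.prems(1) by simp
    show "1 \<in> T - Q n" "\<forall>u\<in>T - Q n. \<forall>v\<in>T - Q n. u * v \<in> T - Q n"
      using Qn(1) is_subring_closed(1,5)[OF T] by (auto simp: prime_in_def)
  qed (use sub in auto)
  then obtain P where P: "prime_in T P" "P \<inter> S = q (Suc n)" "P \<inter> (T - Q n) = {}"
    by (elim exE conjE)
  have "P \<subseteq> Q n" using P(1,3) by (auto simp: prime_in_def ideal_in_def)
  then show ?case
    using Q P(1,2) by (intro exI[of _ "Q(Suc n := P)"]) (auto simp: le_Suc_eq less_Suc_eq)
qed

text \<open>For \<open>t\<close> in \<open>P'\<close> but not in \<open>P\<close>, the powers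
  \<open>t ^ 0\<close> to \<open>t ^ card E\<close> are one more than the rank. So modulo the
  contraction \<open>p\<close> they satisfy a relation with some coefficient outside
  \<open>p\<close>, and the descent below forces all coefficients into \<open>P\<close>.\<close>

lemma prime_in_contraction_inj:
  assumes P: "prime_in T P" and P': "prime_in T P'" and sub: "P \<subseteq> P'" and eq: "P \<inter> S = P' \<inter> S"
  shows "P = P'"
proof (rule ccontr)
  assume "P \<noteq> P'"
  then obtain t where t: "t \<in> P'" "t \<notin> P" using sub by blast
  have Pid: "ideal_in T P" and P'id: "ideal_in T P'" using P P' by (simp_all add: prime_in_def)
  have tT: "t \<in> T" using ideal_in_closed(2)[OF P'id t(1)] .
  define p where "p = P \<inter> S"
  have p: "prime_in S p" unfolding p_def using prime_in_restrict[OF S S_subset_T P] .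
  have "\<forall>i\<in>{..card E}. \<exists>v. (\<forall>k\<in>E. v k \<in> S) \<and> t ^ i = (\<Sum>k\<in>E. v k * e k)"
    using span is_subring_power[OF T tT] by simp
  from bchoice[OF this] obtain v
    where v: "\<forall>i\<in>{..card E}. (\<forall>k\<in>E. v i k \<in> S) \<and> t ^ i = (\<Sum>k\<in>E. v i k * e k)" ..
  have "\<exists>c. (\<forall>i\<in>{..card E}. c i \<in> S) \<and> (\<exists>i\<in>{..card E}. c i \<notin> p) \<and>
      (\<forall>k\<in>E. (\<Sum>i\<le>card E. c i * v i k) \<in> p)"
    using finite_basis v by (intro linear_dependence_mod_prime[OF S p]) auto
  then obtain c where c: "\<forall>i\<in>{..card E}. c i \<in> S" "\<exists>i\<in>{..card E}. c i \<notin> p"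
    "\<forall>k\<in>E. (\<Sum>i\<le>card E. c i * v i k) \<in> p"
    by (elim exE conjE)
  have "(\<Sum>i\<le>card E. c i * t ^ i) = (\<Sum>i\<le>card E. \<Sum>k\<in>E. c i * v i k * e k)"
    using v by (intro sum.cong) (auto simp: sum_distrib_left mult.assoc)
  also have "\<dots> = (\<Sum>k\<in>E. (\<Sum>i\<le>card E. c i * v i k) * e k)"
    unfolding sum_distrib_right by (rule sum.swap)
  also have "\<dots> \<in> P"
  proof (rule ideal_in_sum[OF Pid])
    fix k assume k: "k \<in> E"
    then have "(\<Sum>i\<le>card E. c i * v i k) \<in> P" using c(3) by (simp add: p_def)
    then show "(\<Sum>i\<le>card E. c i * v i k) * e k \<in> P"
      by (rule ideal_in_closed(5)[OF Pid basis_mem[OF k]])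
  qed
  finally have relation: "(\<Sum>i\<le>card E. c i * t ^ i) \<in> P" .
  \<comment> \<open>The constant term lies in \<open>P' \<inter> S\<close>, hence in
    \<open>P\<close>; removing it and cancelling \<open>t\<close>, which is outside the prime
    \<open>P\<close>, lowers the degree.\<close>
  have descent: "(\<forall>i\<le>n. c i \<in> S) \<longrightarrow> (\<Sum>i\<le>n. c i * t ^ i) \<in> P \<longrightarrow> (\<forall>i\<le>n. c i \<in> P)" for n c
  proof (induction n arbitrary: c)
    case 0
    then show ?case by simp
  next
    case (Suc n)
    show ?case
    proof (intro impI)
      assume cS: "\<forall>i\<le>Suc n. c i \<in> S" and f: "(\<Sum>i\<le>Suc n. c i * t ^ i) \<in> P"
      let ?g = "\<Sum>i\<le>n. c (Suc i) * t ^ i"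
      have eq_f: "(\<Sum>i\<le>Suc n. c i * t ^ i) = c 0 + t * ?g"
        unfolding sum.atMost_Suc_shift by (simp add: sum_distrib_left mult.left_commute)
      have gT: "?g \<in> T"
        using cS S_subset_T tT
        by (intro is_subring_sum[OF T] is_subring_closed(5)[OF T] is_subring_power[OF T]) auto
      have "(c 0 + t * ?g) - t * ?g \<in> P'"
        using f eq_f sub ideal_in_closed(5)[OF P'id gT t(1)] by (intro ideal_in_diff[OF T P'id]) auto
      then have c0: "c 0 \<in> P" using cS eq by auto
      then have "(c 0 + t * ?g) - c 0 \<in> P"
        using f eq_f by (intro ideal_in_diff[OF T Pid]) auto
      then have "t * ?g \<in> P" by simp
      then have "?g \<in> P" using P tT gT t(2) by (auto simp: prime_in_def)
      then have "\<forall>i\<le>n. c (Suc i) \<in> P" using Suc.IH[of "\<lambda>i. c (Suc i)"] cS by simp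
      then show "\<forall>i\<le>Suc n. c i \<in> P" using c0 by (metis Suc_le_mono not0_implies_Suc)
    qed
  qed
  have "\<forall>i\<le>card E. c i \<in> P" using descent[of "card E" c] c(1) relation by simp
  then show False using c(1,2) by (auto simp: p_def)
qed

section \<open>Dimension and depth of free extensions\<close>

theorem krull_dim_eq:
  assumes noeth: "noetherian_in T"
  shows "krull_dim (ring_on S) = krull_dim (ring_on T)"
proof -
  have "(\<exists>P. (\<forall>i\<le>n. prime_in S (P i)) \<and> (\<forall>i<n. P i \<subset> P (Suc i))) \<longleftrightarrow>
      (\<exists>P. (\<forall>i\<le>n. prime_in T (P i)) \<and> (\<forall>i<n. P i \<subset> P (Suc i)))" for n
  proof
    assume "\<exists>P. (\<forall>i\<le>n. prime_in S (P i)) \<and> (\<forall>i<n. P i \<subset> P (Suc i))"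
    then obtain P where P: "\<forall>i\<le>n. prime_in S (P i)" "\<forall>i<n. P i \<subset> P (Suc i)"
      by (elim exE conjE)
    \<comment> \<open>Lifting expects descending chains, so the chain is reversed here and the
      lifted one is reversed back.\<close>
    have "\<forall>k<n. P (n - Suc k) \<subseteq> P (n - k)"
    proof (intro allI impI)
      fix k assume "k < n"
      then show "P (n - Suc k) \<subseteq> P (n - k)" using P(2)[rule_format, of "n - Suc k"] by (simp add: Suc_diff_Suc)
    qed
    then obtain Q where Q: "\<forall>k\<le>n. prime_in T (Q k) \<and> Q k \<inter> S = P (n - k)"
      "\<forall>k<n. Q (Suc k) \<subseteq> Q k"
      using lift_prime_chain[OF noeth, of n "\<lambda>k. P (n - k)"] P(1) by auto
    have "\<forall>i<n. Q (n - i) \<subset> Q (n - Suc i)"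
    proof (intro allI impI psubsetI)
      fix i assume i: "i < n"
      show "Q (n - i) \<subseteq> Q (n - Suc i)"
        using Q(2)[rule_format, of "n - Suc i"] i by (simp add: Suc_diff_Suc)
      \<comment> \<open>Going down gives only weak inclusions; strictness comes back from the
        distinct contractions.\<close>
      have "Q (n - i) \<inter> S = P i" "Q (n - Suc i) \<inter> S = P (Suc i)" using Q(1) i by simp_all
      then show "Q (n - i) \<noteq> Q (n - Suc i)" using P(2) i by auto
    qed
    then show "\<exists>P. (\<forall>i\<le>n. prime_in T (P i)) \<and> (\<forall>i<n. P i \<subset> P (Suc i))"
      using Q(1) by (intro exI[of _ "\<lambda>i. Q (n - i)"]) simp
  next
    assume "\<exists>P. (\<forall>i\<le>n. prime_in T (P i)) \<and> (\<forall>i<n. P i \<subset> P (Suc i))"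
    then obtain P where P: "\<forall>i\<le>n. prime_in T (P i)" "\<forall>i<n. P i \<subset> P (Suc i)"
      by (elim exE conjE)
    have "\<forall>i<n. P i \<inter> S \<subset> P (Suc i) \<inter> S"
    proof (intro allI impI psubsetI)
      fix i assume i: "i < n"
      show "P i \<inter> S \<subseteq> P (Suc i) \<inter> S" using P(2) i by blast
      show "P i \<inter> S \<noteq> P (Suc i) \<inter> S"
        using prime_in_contraction_inj[of "P i" "P (Suc i)"] P i by auto
    qed
    then show "\<exists>P. (\<forall>i\<le>n. prime_in S (P i)) \<and> (\<forall>i<n. P i \<subset> P (Suc i))"
      using prime_in_restrict[OF S S_subset_T] P(1) by (intro exI[of _ "\<lambda>i. P i \<inter> S"]) simp
  qed
  then show ?thesis
    unfolding krull_dim_def primeideal_ring_on_iff[OF S] primeideal_ring_on_iff[OF T] by simp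
qed

lemma genideal_eq_ext:
  assumes Y: "Y \<subseteq> S"
  shows "Idl\<^bsub>ring_on T\<^esub> Y = ext (Idl\<^bsub>ring_on S\<^esub> Y)"
proof
  have YT: "Y \<subseteq> T" using Y S_subset_T by simp
  note idS = ideal_in_genideal[OF S Y] and idT = ideal_in_genideal[OF T YT]
  have "Idl\<^bsub>ring_on S\<^esub> Y \<subseteq> S" "0 \<in> Idl\<^bsub>ring_on S\<^esub> Y" using idS by (simp_all add: ideal_in_def)
  then have "Y \<subseteq> ext (Idl\<^bsub>ring_on S\<^esub> Y)"
    using mem_ext_iff genideal_superset[OF S Y] Y by blast
  then show "Idl\<^bsub>ring_on T\<^esub> Y \<subseteq> ext (Idl\<^bsub>ring_on S\<^esub> Y)"
    using genideal_subset[OF T YT ideal_in_ext[OF idS]] by simp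
  have "Idl\<^bsub>ring_on S\<^esub> Y \<subseteq> Idl\<^bsub>ring_on T\<^esub> Y \<inter> S"
    using genideal_superset[OF T YT] Y
    by (intro genideal_subset[OF S Y ideal_in_restrict[OF S S_subset_T idT]]) simp
  then show "ext (Idl\<^bsub>ring_on S\<^esub> Y) \<subseteq> Idl\<^bsub>ring_on T\<^esub> Y" by (intro ext_subset[OF idT]) simp
qed

text \<open>From \<open>S\<close> to \<open>T\<close> nonzerodivisors persist coordinatewise; from
  \<open>T\<close> to \<open>S\<close> both regularity and properness restrict because an extended
  ideal contracts to itself.\<close>

lemma regular_sequence_iff:
  assumes xs: "set xs \<subseteq> S"
  shows "regular_sequence (ring_on S) xs \<longleftrightarrow> regular_sequence (ring_on T) xs"
proof -
  have take: "set (take i xs) \<subseteq> S" for i using xs set_take_subset[of i xs] by simp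
  have mem: "s \<in> ext (Idl\<^bsub>ring_on S\<^esub> Y) \<longleftrightarrow> s \<in> Idl\<^bsub>ring_on S\<^esub> Y" if "Y \<subseteq> S" "s \<in> S" for s Y
    using mem_ext_iff[OF _ _ that(2)] ideal_in_genideal[OF S that(1)] by (simp add: ideal_in_def)
  have "(\<forall>r\<in>S. r * x \<in> Idl\<^bsub>ring_on S\<^esub> Y \<longrightarrow> r \<in> Idl\<^bsub>ring_on S\<^esub> Y) \<longleftrightarrow>
      (\<forall>r\<in>T. r * x \<in> Idl\<^bsub>ring_on T\<^esub> Y \<longrightarrow> r \<in> Idl\<^bsub>ring_on T\<^esub> Y)"
    if "Y \<subseteq> S" "x \<in> S" for x Y
  proof
    assume "\<forall>r\<in>S. r * x \<in> Idl\<^bsub>ring_on S\<^esub> Y \<longrightarrow> r \<in> Idl\<^bsub>ring_on S\<^esub> Y"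
    then show "\<forall>r\<in>T. r * x \<in> Idl\<^bsub>ring_on T\<^esub> Y \<longrightarrow> r \<in> Idl\<^bsub>ring_on T\<^esub> Y"
      unfolding genideal_eq_ext[OF that(1)]
      using mult_mem_ext_cancel[OF ideal_in_genideal[OF S that(1)] that(2)] by simp
  next
    assume *: "\<forall>r\<in>T. r * x \<in> Idl\<^bsub>ring_on T\<^esub> Y \<longrightarrow> r \<in> Idl\<^bsub>ring_on T\<^esub> Y"
    show "\<forall>r\<in>S. r * x \<in> Idl\<^bsub>ring_on S\<^esub> Y \<longrightarrow> r \<in> Idl\<^bsub>ring_on S\<^esub> Y"
    proof (intro ballI impI)
      fix r assume r: "r \<in> S" "r * x \<in> Idl\<^bsub>ring_on S\<^esub> Y"
      then have "r * x \<in> Idl\<^bsub>ring_on T\<^esub> Y"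
        unfolding genideal_eq_ext[OF that(1)] using mem[OF that(1)] that(2) is_subring_closed(5)[OF S]
        by simp
      then have "r \<in> Idl\<^bsub>ring_on T\<^esub> Y" using * r(1) S_subset_T by auto
      then show "r \<in> Idl\<^bsub>ring_on S\<^esub> Y"
        unfolding genideal_eq_ext[OF that(1)] using mem[OF that(1) r(1)] by simp
    qed
  qed
  then have "(\<forall>i<length xs. \<forall>r\<in>S. r * (xs ! i) \<in> Idl\<^bsub>ring_on S\<^esub> (set (take i xs)) \<longrightarrow>
        r \<in> Idl\<^bsub>ring_on S\<^esub> (set (take i xs))) \<longleftrightarrow>
      (\<forall>i<length xs. \<forall>r\<in>T. r * (xs ! i) \<in> Idl\<^bsub>ring_on T\<^esub> (set (take i xs)) \<longrightarrow>
        r \<in> Idl\<^bsub>ring_on T\<^esub> (set (take i xs)))"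
    using take xs by (meson nth_mem subsetD)
  moreover have "Idl\<^bsub>ring_on S\<^esub> (set xs) \<noteq> S \<longleftrightarrow> Idl\<^bsub>ring_on T\<^esub> (set xs) \<noteq> T"
    unfolding ideal_in_proper_iff[OF S ideal_in_genideal[OF S xs]]
      ideal_in_proper_iff[OF T ideal_in_genideal[OF T order.trans[OF xs S_subset_T]]]
    unfolding genideal_eq_ext[OF xs] using mem[OF xs is_subring_closed(1)[OF S]] by simp
  ultimately show ?thesis
    unfolding regular_sequence_def using xs S_subset_T by auto
qed

text \<open>The condition on primes says that \<open>N\<close> lies in the radical of
  \<open>M T\<close>. Hence a prime not containing \<open>N\<close> does not contain
  \<open>M\<close>, and prime avoidance can be carried out inside \<open>M\<close>.\<close>

theorem depth_eq:
  assumes noeth: "noetherian_in T" and M: "ideal_in S M" "1 \<notin> M"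
    and N: "M \<subseteq> N" "N \<subseteq> T" "\<forall>P. prime_in T P \<longrightarrow> M \<subseteq> P \<longrightarrow> N \<subseteq> P"
  shows "depth (ring_on S) M = depth (ring_on T) N"
proof -
  have MS: "M \<subseteq> S" using M by (simp add: ideal_in_def)
  have "(\<exists>xs. n = length xs \<and> regular_sequence (ring_on S) xs \<and> set xs \<subseteq> M) \<longleftrightarrow>
      (\<exists>xs. n = length xs \<and> regular_sequence (ring_on T) xs \<and> set xs \<subseteq> N)" for n
  proof
    assume "\<exists>xs. n = length xs \<and> regular_sequence (ring_on S) xs \<and> set xs \<subseteq> M"
    then obtain xs where "n = length xs" "regular_sequence (ring_on S) xs" "set xs \<subseteq> M"
      by (elim exE conjE)
    then show "\<exists>xs. n = length xs \<and> regular_sequence (ring_on T) xs \<and> set xs \<subseteq> N"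
      using regular_sequence_iff[of xs] MS N(1) by (intro exI[of _ xs]) auto
  next
    assume "\<exists>xs. n = length xs \<and> regular_sequence (ring_on T) xs \<and> set xs \<subseteq> N"
    then obtain ts where ts: "n = length ts" "regular_sequence (ring_on T) ts" "set ts \<subseteq> N"
      by (elim exE conjE)
    then have "regular_mod T {0} ts" using regular_sequence_ring_on_iff[OF T] by simp
    from regular_mod_exchange[OF T noeth S S_subset_T M(1) N(2,3) ideal_in_zero[OF T] this ts(3)]
    obtain ss where ss: "length ss = length ts" "set ss \<subseteq> M" "regular_mod T {0} ss"
      by (elim exE conjE)
    \<comment> \<open>Properness, which the exchange did not track: \<open>ss\<close> generates an
      ideal inside \<open>M\<close>, and \<open>1 \<notin> M\<close>.\<close>
    have ssS: "set ss \<subseteq> S" using ss(2) MS by simp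
    have "Idl\<^bsub>ring_on S\<^esub> (set ss) \<subseteq> M" using genideal_subset[OF S ssS M(1) ss(2)] .
    then have "1 \<notin> Idl\<^bsub>ring_on S\<^esub> (set ss)" using M(2) by blast
    then have "1 \<notin> Idl\<^bsub>ring_on T\<^esub> (set ss)"
      unfolding genideal_eq_ext[OF ssS]
      using mem_ext_iff[of "Idl\<^bsub>ring_on S\<^esub> (set ss)" 1] ideal_in_genideal[OF S ssS]
        is_subring_closed(1)[OF S] by (simp add: ideal_in_def)
    then have "regular_sequence (ring_on T) ss"
      using regular_sequence_ring_on_iff[OF T] ss(3) ssS S_subset_T is_subring_closed(1)[OF T] by auto
    then show "\<exists>xs. n = length xs \<and> regular_sequence (ring_on S) xs \<and> set xs \<subseteq> M"
      using regular_sequence_iff[OF ssS] ss ts(1) by (intro exI[of _ ss]) simp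
  qed
  then have "{enat (length xs) | xs. regular_sequence (ring_on S) xs \<and> set xs \<subseteq> M} =
      {enat (length xs) | xs. regular_sequence (ring_on T) xs \<and> set xs \<subseteq> N}" by fastforce
  then show ?thesis unfolding depth_def by simp
qed

end

subsection \<open>Invariance under ring isomorphisms\<close>

lemma ring_iso_inverse:
  assumes R: "cring R" and Q: "cring Q" and h: "h \<in> ring_iso R Q"
  defines "g \<equiv> inv_into (carrier R) h"
  shows "g \<in> ring_iso Q R" "\<And>x. x \<in> carrier R \<Longrightarrow> g (h x) = x" "\<And>x. x \<in> carrier Q \<Longrightarrow> h (g x) = x"
    "\<And>x. x \<in> carrier R \<Longrightarrow> h x \<in> carrier Q" "\<And>x. x \<in> carrier Q \<Longrightarrow> g x \<in> carrier R"
    "ring_hom_ring R Q h"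
proof -
  show "g \<in> ring_iso Q R" unfolding g_def using ring_iso_set_sym[OF cring.axioms(1)[OF R] h] .
  have bij: "bij_betw h (carrier R) (carrier Q)" using ring_iso_memE(5)[OF h] .
  show "\<And>x. x \<in> carrier R \<Longrightarrow> g (h x) = x"
    unfolding g_def using bij by (simp add: bij_betw_def)
  show "\<And>x. x \<in> carrier Q \<Longrightarrow> h (g x) = x"
    unfolding g_def using bij by (simp add: bij_betw_inv_into_right)
  show "\<And>x. x \<in> carrier R \<Longrightarrow> h x \<in> carrier Q" using ring_iso_memE(1)[OF h] .
  show "\<And>x. x \<in> carrier Q \<Longrightarrow> g x \<in> carrier R"
    using ring_iso_memE(1)[OF \<open>g \<in> ring_iso Q R\<close>] .
  show "ring_hom_ring R Q h"
    using R Q h by (auto simp: ring_hom_ring_def ring_hom_ring_axioms_def cring_def ring_iso_def)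
qed

text \<open>Primes are pulled back along \<open>h\<close>. One inequality is enough, since it
  applies to the inverse isomorphism as well.\<close>

lemma krull_dim_le_ring_iso:
  assumes R: "cring R" and Q: "cring Q" and h: "h \<in> ring_iso R Q"
  shows "krull_dim Q \<le> krull_dim R"
proof -
  interpret ring_hom_ring R Q h using ring_iso_inverse(6)[OF assms] .
  define pull where "pull P = {r \<in> carrier R. h r \<in> P}" for P
  have pull_prime: "primeideal (pull P) R" if "primeideal P Q" for P
    unfolding pull_def using primeideal_vimage[OF R that] .
  have pull_strict: "pull P \<subset> pull P'" if P: "primeideal P' Q" "P \<subset> P'" for P P'
  proof
    show "pull P \<subseteq> pull P'" using P(2) by (auto simp: pull_def)
    obtain x where x: "x \<in> P'" "x \<notin> P" using P(2) by blast
    have "x \<in> carrier Q"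
      using x(1) P(1) by (meson additive_subgroup.a_Hcarr ideal.axioms(1) primeideal.axioms(1))
    then have "inv_into (carrier R) h x \<in> pull P'" "inv_into (carrier R) h x \<notin> pull P"
      using x ring_iso_inverse(3,5)[OF assms] by (simp_all add: pull_def)
    then show "pull P \<noteq> pull P'" by blast
  qed
  have "\<exists>P. (\<forall>i\<le>n. primeideal (P i) R) \<and> (\<forall>i<n. P i \<subset> P (Suc i))"
    if P: "(\<forall>i\<le>n. primeideal (P i) Q) \<and> (\<forall>i<n. P i \<subset> P (Suc i))" for n :: nat and P
    using P pull_prime pull_strict by (intro exI[of _ "\<lambda>i. pull (P i)"]) simp
  then show ?thesis
    unfolding krull_dim_def by (intro Sup_subset_mono) blast
qed

lemma krull_dim_ring_iso:
  assumes "cring R" "cring Q" "h \<in> ring_iso R Q"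
  shows "krull_dim R = krull_dim Q"
  using krull_dim_le_ring_iso[OF assms] krull_dim_le_ring_iso[OF assms(2,1) ring_iso_inverse(1)[OF assms]]
  by simp

lemma genideal_ring_iso_subset:
  assumes R: "cring R" and Q: "cring Q" and h: "h \<in> ring_iso R Q" and Y: "Y \<subseteq> carrier R"
  shows "h ` (Idl\<^bsub>R\<^esub> Y) \<subseteq> Idl\<^bsub>Q\<^esub> (h ` Y)"
proof -
  interpret ring_hom_ring R Q h using ring_iso_inverse(6)[OF R Q h] .
  have hY: "h ` Y \<subseteq> carrier Q" using Y by auto
  have "ideal {r \<in> carrier R. h r \<in> Idl\<^bsub>Q\<^esub> (h ` Y)} R"
    using ideal_vimage[OF S.genideal_ideal[OF hY]] .
  moreover have "Y \<subseteq> {r \<in> carrier R. h r \<in> Idl\<^bsub>Q\<^esub> (h ` Y)}"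
    using Y S.genideal_self[OF hY] by auto
  ultimately have "Idl\<^bsub>R\<^esub> Y \<subseteq> {r \<in> carrier R. h r \<in> Idl\<^bsub>Q\<^esub> (h ` Y)}"
    by (rule R.genideal_minimal)
  then show ?thesis by blast
qed

lemma genideal_ring_iso:
  assumes R: "cring R" and Q: "cring Q" and h: "h \<in> ring_iso R Q" and Y: "Y \<subseteq> carrier R"
  shows "h ` (Idl\<^bsub>R\<^esub> Y) = Idl\<^bsub>Q\<^esub> (h ` Y)"
proof
  define g where "g = inv_into (carrier R) h"
  note g = ring_iso_inverse[OF R Q h, folded g_def]
  show "h ` (Idl\<^bsub>R\<^esub> Y) \<subseteq> Idl\<^bsub>Q\<^esub> (h ` Y)" using genideal_ring_iso_subset[OF R Q h Y] .
  have hY: "h ` Y \<subseteq> carrier Q" using Y g(4) by auto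
  have "g ` h ` Y = Y" using Y g(2) by (auto simp: image_iff subset_iff)
  then have sub: "g ` (Idl\<^bsub>Q\<^esub> (h ` Y)) \<subseteq> Idl\<^bsub>R\<^esub> Y"
    using genideal_ring_iso_subset[OF Q R g(1) hY] by simp
  show "Idl\<^bsub>Q\<^esub> (h ` Y) \<subseteq> h ` (Idl\<^bsub>R\<^esub> Y)"
  proof
    fix x assume x: "x \<in> Idl\<^bsub>Q\<^esub> (h ` Y)"
    interpret I: ideal "Idl\<^bsub>Q\<^esub> (h ` Y)" Q
      using ring.genideal_ideal[OF cring.axioms(1)[OF Q] hY] .
    have "x = h (g x)" using g(3)[OF I.a_Hcarr[OF x]] by simp
    then show "x \<in> h ` (Idl\<^bsub>R\<^esub> Y)" using sub x by blast
  qed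
qed

lemma regular_sequence_ring_iso:
  assumes R: "cring R" and Q: "cring Q" and h: "h \<in> ring_iso R Q"
    and xs: "regular_sequence R xs"
  shows "regular_sequence Q (map h xs)"
proof -
  define g where "g = inv_into (carrier R) h"
  note g = ring_iso_inverse[OF R Q h, folded g_def]
  have xsR: "set xs \<subseteq> carrier R" using xs by (simp add: regular_sequence_def)
  have takeR: "set (take i xs) \<subseteq> carrier R" for i using xsR set_take_subset[of i xs] by simp
  have IdlR: "Idl\<^bsub>R\<^esub> Y \<subseteq> carrier R" if "Y \<subseteq> carrier R" for Y
    using ring.genideal_ideal[OF cring.axioms(1)[OF R] that]
    by (simp add: additive_subgroup.a_subset ideal.axioms(1))
  have mem: "h x \<in> Idl\<^bsub>Q\<^esub> (h ` Y) \<longleftrightarrow> x \<in> Idl\<^bsub>R\<^esub> Y" if Y: "Y \<subseteq> carrier R" and x: "x \<in> carrier R" for x Y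
  proof
    assume "h x \<in> Idl\<^bsub>Q\<^esub> (h ` Y)"
    then obtain y where "y \<in> Idl\<^bsub>R\<^esub> Y" "h x = h y" using genideal_ring_iso[OF R Q h Y] by auto
    then show "x \<in> Idl\<^bsub>R\<^esub> Y" using g(2) x IdlR[OF Y] by (metis subsetD)
  qed (use genideal_ring_iso[OF R Q h Y] in blast)
  have "r \<in> Idl\<^bsub>Q\<^esub> (set (take i (map h xs)))"
    if i: "i < length (map h xs)" and r: "r \<in> carrier Q"
      and *: "r \<otimes>\<^bsub>Q\<^esub> (map h xs ! i) \<in> Idl\<^bsub>Q\<^esub> (set (take i (map h xs)))" for i r
  proof -
    have xi: "xs ! i \<in> carrier R" using xsR i by auto
    have eq: "set (take i (map h xs)) = h ` set (take i xs)" by (simp add: take_map)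
    have rr: "r = h (g r)" "g r \<in> carrier R" using g(3,5)[OF r] by simp_all
    have "r \<otimes>\<^bsub>Q\<^esub> (map h xs ! i) = h (g r \<otimes>\<^bsub>R\<^esub> (xs ! i))"
      using ring_iso_memE(2)[OF h rr(2) xi] rr(1) i by simp
    then have "g r \<otimes>\<^bsub>R\<^esub> (xs ! i) \<in> Idl\<^bsub>R\<^esub> (set (take i xs))"
      using * mem[OF takeR, of "g r \<otimes>\<^bsub>R\<^esub> (xs ! i)"] rr(2) xi R
      unfolding eq by (simp add: cring_def ring.ring_simprules)
    then have "g r \<in> Idl\<^bsub>R\<^esub> (set (take i xs))"
      using xs i rr(2) by (simp add: regular_sequence_def)
    then show ?thesis unfolding eq using mem[OF takeR rr(2)] rr(1) by simp
  qed
  moreover have "Idl\<^bsub>Q\<^esub> (set (map h xs)) \<noteq> carrier Q"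
  proof
    assume *: "Idl\<^bsub>Q\<^esub> (set (map h xs)) = carrier Q"
    have "carrier R \<subseteq> Idl\<^bsub>R\<^esub> (set xs)" using mem[OF xsR] * g(4) by auto
    then show False using IdlR[OF xsR] xs by (auto simp: regular_sequence_def)
  qed
  moreover have "set (map h xs) \<subseteq> carrier Q" using xsR g(4) by auto
  ultimately show ?thesis unfolding regular_sequence_def by blast
qed

lemma depth_le_ring_iso:
  assumes R: "cring R" and Q: "cring Q" and h: "h \<in> ring_iso R Q"
  shows "depth R I \<le> depth Q (h ` I)"
proof -
  have "{enat (length xs) | xs. regular_sequence R xs \<and> set xs \<subseteq> I} \<subseteq>
      {enat (length xs) | xs. regular_sequence Q xs \<and> set xs \<subseteq> h ` I}"
  proof
    fix n assume "n \<in> {enat (length xs) | xs. regular_sequence R xs \<and> set xs \<subseteq> I}"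
    then obtain xs where "n = enat (length xs)" "regular_sequence R xs" "set xs \<subseteq> I" by auto
    then show "n \<in> {enat (length xs) | xs. regular_sequence Q xs \<and> set xs \<subseteq> h ` I}"
      using regular_sequence_ring_iso[OF R Q h, of xs]
      by (intro CollectI exI[of _ "map h xs"]) auto
  qed
  then show ?thesis unfolding depth_def by (rule Sup_subset_mono)
qed

lemma depth_ring_iso:
  assumes R: "cring R" and Q: "cring Q" and h: "h \<in> ring_iso R Q" and I: "I \<subseteq> carrier R"
  shows "depth R I = depth Q (h ` I)"
proof -
  define g where "g = inv_into (carrier R) h"
  note g = ring_iso_inverse[OF R Q h, folded g_def]
  have "g ` h ` I = I" using I g(2) by (auto simp: image_iff subset_iff)
  then show ?thesis
    using depth_le_ring_iso[OF R Q h, of I] depth_le_ring_iso[OF Q R g(1), of "h ` I"] by simp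
qed

subsection \<open>Linear maps and substitutions on polynomials\<close>

lemma mpol_const_simps [simp]:
  "mpol_const 0 = 0" "mpol_const 1 = 1"
  "mpol_const (c + d) = mpol_const c + mpol_const d"
  "mpol_const (c * d) = mpol_const c * mpol_const d"
  "mpol_const (- c) = - mpol_const c"
  by (simp_all add: mpol_const_def single_add mult_single single_uminus)

lemma mpol_var_power: "mpol_var v ^ n = Poly_Mapping.single (Poly_Mapping.single v n) 1"
proof (induction n)
  case (Suc n)
  then show ?case by (simp add: mpol_var_def mult_single single_add[symmetric])
qed simp

lemma mpol_sum_monomials:
  fixes f :: "('v, 'k::comm_ring_1) mpol"
  shows "f = (\<Sum>m\<in>Poly_Mapping.keys f. Poly_Mapping.single m (Poly_Mapping.lookup f m))"
proof (rule poly_mapping_eqI)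
  fix k
  have "(\<Sum>m\<in>Poly_Mapping.keys f. Poly_Mapping.lookup (Poly_Mapping.single m (Poly_Mapping.lookup f m)) k) =
      (\<Sum>m\<in>Poly_Mapping.keys f. if m = k then Poly_Mapping.lookup f m else 0)"
    by (intro sum.cong) (auto simp: lookup_single when_def)
  then show "Poly_Mapping.lookup f k =
      Poly_Mapping.lookup (\<Sum>m\<in>Poly_Mapping.keys f. Poly_Mapping.single m (Poly_Mapping.lookup f m)) k"
    by (simp add: lookup_sum in_keys_iff)
qed

lemma mpol_induct [case_names single add]:
  fixes f :: "('v, 'k::comm_ring_1) mpol"
  assumes single: "\<And>m c. P (Poly_Mapping.single m c)" and add: "\<And>f g. P f \<Longrightarrow> P g \<Longrightarrow> P (f + g)"
  shows "P f"
proof -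
  have "P (\<Sum>m\<in>A. Poly_Mapping.single m (Poly_Mapping.lookup f m))" if "finite A" for A
    using that
  proof (induction A rule: finite_induct)
    case empty
    show ?case using single[of 0 0] by simp
  qed (simp add: single add)
  then show ?thesis using mpol_sum_monomials[of f] finite_keys[of f] by metis
qed

text \<open>The linear map with prescribed values on monomials. The weight need not be
  multiplicative: the coefficients of a remainder are of this kind as well as substitutions.\<close>

definition mpol_lin ::
    "(('v \<Rightarrow>\<^sub>0 nat) \<Rightarrow> ('w, 'k) mpol) \<Rightarrow> ('v, 'k::comm_ring_1) mpol \<Rightarrow> ('w, 'k) mpol" where
  "mpol_lin w f = (\<Sum>m\<in>Poly_Mapping.keys f. mpol_const (Poly_Mapping.lookup f m) * w m)"

lemma mpol_lin_superset:
  assumes "finite A" "Poly_Mapping.keys f \<subseteq> A"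
  shows "mpol_lin w f = (\<Sum>m\<in>A. mpol_const (Poly_Mapping.lookup f m) * w m)"
  unfolding mpol_lin_def using assms by (intro sum.mono_neutral_left) (auto simp: in_keys_iff)

lemma mpol_lin_0 [simp]: "mpol_lin w 0 = 0"
  by (simp add: mpol_lin_def)

lemma mpol_lin_add: "mpol_lin w (f + g) = mpol_lin w f + mpol_lin w g"
proof -
  let ?A = "Poly_Mapping.keys f \<union> Poly_Mapping.keys g"
  have "Poly_Mapping.keys (f + g) \<subseteq> ?A" by (rule Poly_Mapping.keys_add)
  then show ?thesis
    by (simp add: mpol_lin_superset[of ?A] lookup_add sum.distrib ring_distribs)
qed

lemma mpol_lin_sum: "mpol_lin w (sum f A) = (\<Sum>i\<in>A. mpol_lin w (f i))"
  by (induction A rule: infinite_finite_induct) (simp_all add: mpol_lin_add)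

lemma mpol_lin_uminus: "mpol_lin w (- f) = - mpol_lin w f"
  using mpol_lin_add[of w f "- f"] by (simp add: eq_neg_iff_add_eq_0 add.commute)

lemma mpol_lin_diff: "mpol_lin w (f - g) = mpol_lin w f - mpol_lin w g"
  using mpol_lin_add[of w f "- g"] by (simp add: mpol_lin_uminus)

lemma mpol_lin_single [simp]: "mpol_lin w (Poly_Mapping.single m c) = mpol_const c * w m"
  by (cases "c = 0") (simp_all add: mpol_lin_def)

lemma mpol_lin_mult:
  assumes w: "\<And>m m'. w (m + m') = u m * w m'"
  shows "mpol_lin w (f * g) = mpol_lin u f * mpol_lin w g"
proof (induction f rule: mpol_induct)
  case (single m c)
  show ?case
  proof (induction g rule: mpol_induct)
    case (single m' d)
    show ?case by (simp add: mult_single w mult.assoc mult.left_commute)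
  qed (simp add: mpol_lin_add ring_distribs)
qed (simp add: mpol_lin_add ring_distribs)

lemma mpol_lin_shift:
  assumes w: "\<And>m. w (s + m) = z * w m"
  shows "mpol_lin w (Poly_Mapping.single s 1 * g) = z * mpol_lin w g"
proof (induction g rule: mpol_induct)
  case (single m d)
  show ?case by (simp add: mult_single w mult.left_commute)
qed (simp add: mpol_lin_add ring_distribs)

lemma mpol_lin_scale: "mpol_lin w (mpol_const c * g) = mpol_const c * mpol_lin w g"
proof (induction g rule: mpol_induct)
  case (single m d)
  have "mpol_const c * Poly_Mapping.single m d = Poly_Mapping.single m (c * d)"
    by (simp add: mpol_const_def mult_single)
  then show ?case by (simp add: mult.assoc)
qed (simp add: mpol_lin_add ring_distribs)

text \<open>The product runs over all variables instead of the support of \<open>m\<close>, so it is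
  multiplicative in \<open>m\<close> without comparing supports.\<close>

definition mpol_monom :: "('v::finite \<Rightarrow> ('w, 'k::comm_ring_1) mpol) \<Rightarrow> ('v \<Rightarrow>\<^sub>0 nat) \<Rightarrow> ('w, 'k) mpol" where
  "mpol_monom \<phi> m = (\<Prod>v\<in>UNIV. \<phi> v ^ Poly_Mapping.lookup m v)"

lemma mpol_monom_add: "mpol_monom \<phi> (m + m') = mpol_monom \<phi> m * mpol_monom \<phi> m'"
  by (simp add: mpol_monom_def lookup_add power_add prod.distrib)

lemma mpol_subst_eq_lin: "mpol_subst \<phi> = mpol_lin (mpol_monom \<phi>)"
proof
  have "(\<Prod>v\<in>Poly_Mapping.keys m. \<phi> v ^ Poly_Mapping.lookup m v) = mpol_monom \<phi> m" for m
    unfolding mpol_monom_def by (intro prod.mono_neutral_left) (auto simp: in_keys_iff)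
  then show "mpol_subst \<phi> f = mpol_lin (mpol_monom \<phi>) f" for f
    by (simp add: mpol_subst_def mpol_lin_def)
qed

lemma mpol_subst_hom:
  fixes \<phi> :: "'v::finite \<Rightarrow> ('w, 'k::comm_ring_1) mpol"
  shows "mpol_subst \<phi> (f + g) = mpol_subst \<phi> f + mpol_subst \<phi> g"
    "mpol_subst \<phi> (f - g) = mpol_subst \<phi> f - mpol_subst \<phi> g"
    "mpol_subst \<phi> (f * g) = mpol_subst \<phi> f * mpol_subst \<phi> g"
    "mpol_subst \<phi> (mpol_const c) = mpol_const c"
    "mpol_subst \<phi> 0 = 0" "mpol_subst \<phi> 1 = 1"
  unfolding mpol_subst_eq_lin
proof -
  show const: "mpol_lin (mpol_monom \<phi>) (mpol_const c) = mpol_const c" for c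
    using mpol_lin_single[of "mpol_monom \<phi>" 0 c] by (simp add: mpol_const_def[symmetric] mpol_monom_def)
  show "mpol_lin (mpol_monom \<phi>) 1 = 1" using const[of 1] by simp
qed (simp_all add: mpol_lin_add mpol_lin_diff mpol_lin_mult[of _ "mpol_monom \<phi>", OF mpol_monom_add])

lemma mpol_subst_var [simp]:
  fixes \<phi> :: "'v::finite \<Rightarrow> ('w, 'k::comm_ring_1) mpol"
  shows "mpol_subst \<phi> (mpol_var v) = \<phi> v"
proof -
  have "mpol_monom \<phi> (Poly_Mapping.single v 1) = (\<Prod>u\<in>UNIV. if u = v then \<phi> u else 1)"
    unfolding mpol_monom_def by (intro prod.cong) (auto simp: lookup_single when_def)
  then show ?thesis by (simp add: mpol_subst_eq_lin mpol_var_def)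
qed

lemma mpol_subst_sum:
  fixes \<phi> :: "'v::finite \<Rightarrow> ('w, 'k::comm_ring_1) mpol"
  shows "mpol_subst \<phi> (sum f A) = (\<Sum>i\<in>A. mpol_subst \<phi> (f i))"
  by (induction A rule: infinite_finite_induct) (simp_all add: mpol_subst_hom)

lemma mpol_subst_power:
  fixes \<phi> :: "'v::finite \<Rightarrow> ('w, 'k::comm_ring_1) mpol"
  shows "mpol_subst \<phi> (f ^ n) = mpol_subst \<phi> f ^ n"
  by (induction n) (simp_all add: mpol_subst_hom)

lemma mpol_subst_prod:
  fixes \<phi> :: "'v::finite \<Rightarrow> ('w, 'k::comm_ring_1) mpol"
  shows "mpol_subst \<phi> (prod f A) = (\<Prod>i\<in>A. mpol_subst \<phi> (f i))"
  by (induction A rule: infinite_finite_induct) (simp_all add: mpol_subst_hom)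

lemma mpol_subst_monom:
  fixes \<psi> :: "'u::finite \<Rightarrow> ('v::finite, 'k::comm_ring_1) mpol"
  shows "mpol_subst \<phi> (mpol_monom \<psi> m) = mpol_monom (\<lambda>v. mpol_subst \<phi> (\<psi> v)) m"
  by (simp add: mpol_monom_def mpol_subst_prod mpol_subst_power)

lemma mpol_subst_subst:
  fixes \<psi> :: "'u::finite \<Rightarrow> ('v::finite, 'k::comm_ring_1) mpol"
  shows "mpol_subst \<phi> (mpol_subst \<psi> f) = mpol_subst (\<lambda>u. mpol_subst \<phi> (\<psi> u)) f"
proof (induction f rule: mpol_induct)
  case (single m c)
  show ?case
    using mpol_subst_hom(3)[of \<phi> "mpol_const c"] mpol_subst_hom(4)[of \<phi> c]
    by (simp add: mpol_subst_eq_lin[of \<psi>] mpol_subst_eq_lin[of "\<lambda>u. mpol_subst \<phi> (\<psi> u)"]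
        mpol_subst_monom)
qed (simp add: mpol_subst_hom)

lemma mpol_lin_prod_mult:
  assumes "\<And>v h. mpol_lin w (\<phi> v * h) = \<psi> v * mpol_lin w h"
  shows "mpol_lin w ((\<Prod>v\<in>A. \<phi> v ^ n v) * h) = (\<Prod>v\<in>A. \<psi> v ^ n v) * mpol_lin w h"
proof -
  have "mpol_lin w (\<phi> v ^ k * h) = \<psi> v ^ k * mpol_lin w h" for v k h
    by (induction k) (simp_all add: assms mult.assoc)
  then show ?thesis
    by (induction A rule: infinite_finite_induct) (simp_all add: mult.assoc)
qed

text \<open>Compatibility with multiplication by the images of the variables spreads to every
  polynomial in them. This is how a map that is linear over the constants is shown to be linear over
  a subring.\<close>

lemma mpol_lin_subst_mult:
  fixes \<phi> :: "'u::finite \<Rightarrow> ('v, 'k::comm_ring_1) mpol"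
  assumes "\<And>v h. mpol_lin w (\<phi> v * h) = \<psi> v * mpol_lin w h"
  shows "mpol_lin w (mpol_subst \<phi> g * h) = mpol_subst \<psi> g * mpol_lin w h"
proof (induction g rule: mpol_induct)
  case (single m c)
  show ?case
    using mpol_lin_prod_mult[of w \<phi> \<psi>, OF assms, of "Poly_Mapping.lookup m" UNIV h]
    by (simp add: mpol_subst_eq_lin mpol_monom_def[symmetric] mult.assoc mpol_lin_scale)
qed (simp add: mpol_subst_hom mpol_lin_add ring_distribs)

text \<open>The substitution multiplies every exponent vector by \<open>k\<close>. This is
  injective, so no terms merge, and the coefficient of \<open>f\<close> at \<open>m0\<close>
  reappears at \<open>K m0\<close>.\<close>

lemma mpol_subst_power_inj:
  fixes f :: "('n::finite, 'k::comm_ring_1) mpol"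
  assumes k: "0 < k" and "mpol_subst (\<lambda>i. mpol_var i ^ k) f = 0"
  shows "f = 0"
proof (rule poly_mapping_eqI)
  fix m0
  define K where "K m = (\<Sum>i\<in>UNIV. Poly_Mapping.single i (k * Poly_Mapping.lookup m i))"
    for m :: "'n \<Rightarrow>\<^sub>0 nat"
  have lookup_K: "Poly_Mapping.lookup (K m) i = k * Poly_Mapping.lookup m i" for m i
    by (simp add: K_def lookup_sum lookup_single when_def)
  have K_inj: "K m = K m' \<longleftrightarrow> m = m'" for m m'
  proof
    assume "K m = K m'"
    then have "Poly_Mapping.lookup (K m) i = Poly_Mapping.lookup (K m') i" for i by simp
    then show "m = m'" using k by (intro poly_mapping_eqI) (simp add: lookup_K)
  qed simp
  have "mpol_monom (\<lambda>i. mpol_var i ^ k :: ('n, 'k) mpol) m = Poly_Mapping.single (K m) 1" for m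
  proof -
    have "(\<Prod>i\<in>A. Poly_Mapping.single (g i) (1::'k)) = Poly_Mapping.single (\<Sum>i\<in>A. g i) 1"
      for g :: "'n \<Rightarrow> ('n \<Rightarrow>\<^sub>0 nat)" and A
      by (induction A rule: infinite_finite_induct) (simp_all add: mult_single)
    moreover have "(mpol_var i ^ k) ^ j = Poly_Mapping.single (Poly_Mapping.single i (k * j)) (1::'k)" for i :: 'n and j
      by (simp only: power_mult mpol_var_power[symmetric])
    ultimately show ?thesis by (simp add: mpol_monom_def K_def)
  qed
  then have "0 = (\<Sum>m\<in>Poly_Mapping.keys f. Poly_Mapping.single (K m) (Poly_Mapping.lookup f m))"
    using assms(2) by (simp add: mpol_subst_eq_lin mpol_lin_def mpol_const_def mult_single)
  then have "Poly_Mapping.lookup 0 (K m0) =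
      Poly_Mapping.lookup (\<Sum>m\<in>Poly_Mapping.keys f. Poly_Mapping.single (K m) (Poly_Mapping.lookup f m)) (K m0)"
    by (rule arg_cong)
  also have "\<dots> = (\<Sum>m\<in>Poly_Mapping.keys f. if m = m0 then Poly_Mapping.lookup f m else 0)"
    unfolding lookup_sum by (intro sum.cong) (auto simp: lookup_single when_def K_inj)
  also have "\<dots> = Poly_Mapping.lookup f m0" by (simp add: in_keys_iff)
  finally show "Poly_Mapping.lookup f m0 = Poly_Mapping.lookup 0 m0" by simp
qed

subsection \<open>Semigroup rings as subrings of a polynomial ring\<close>

definition vec_monom :: "nat ^ 'n \<Rightarrow> ('n::finite, 'k::comm_ring_1) mpol" where
  "vec_monom v = (\<Prod>i\<in>UNIV. mpol_var i ^ (v $ i))"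

lemma toric_map_eq: "toric_map a = mpol_subst (\<lambda>j. vec_monom (a j))"
  by (simp add: toric_map_def vec_monom_def)

lemma mpol_ring_eq: "(mpol_ring :: ('v, 'k::comm_ring_1) mpol ring) = ring_on UNIV"
  by (simp add: ring_on_def ring_of_type_algebra_def)

lemma ring_hom_toric_map:
  fixes a :: "'p::finite \<Rightarrow> nat ^ 'n::finite"
  shows "ring_hom_ring mpol_ring mpol_ring (toric_map a :: ('p, 'k::field) mpol \<Rightarrow> _)"
proof (rule ring_hom_ringI2)
  show "toric_map a \<in> ring_hom mpol_ring mpol_ring"
    by (rule ring_hom_memI) (simp_all add: mpol_ring_eq toric_map_eq mpol_subst_hom)
qed (auto intro: ring_from_type_algebra)

lemma toric_ideal_iff: "f \<in> toric_ideal k a \<longleftrightarrow> toric_map a f = 0"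
  by (simp add: toric_ideal_def a_kernel_def' mpol_ring_eq)

lemma ideal_toric_ideal:
  fixes k :: "'k::field itself" and a :: "'p::finite \<Rightarrow> nat ^ 'n::finite"
  shows "ideal (toric_ideal k a) mpol_ring"
  unfolding toric_ideal_def by (rule ring_hom_ring.kernel_is_ideal[OF ring_hom_toric_map])

lemma is_subring_range_toric_map:
  fixes a :: "'p::finite \<Rightarrow> nat ^ 'n::finite"
  shows "is_subring (range (toric_map a :: ('p, 'k::field) mpol \<Rightarrow> _))"
  unfolding is_subring_def toric_map_eq
  by (auto simp: mpol_subst_hom[symmetric] intro: range_eqI[of _ _ 1])

lemma range_toric_map_const: "mpol_const c \<in> range (toric_map (a :: 'p::finite \<Rightarrow> _))"
  by (rule range_eqI[of _ _ "mpol_const c"]) (simp add: toric_map_eq mpol_subst_hom)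

lemma range_toric_map_vec_monom: "vec_monom (a j) \<in> range (toric_map (a :: 'p::finite \<Rightarrow> _))"
  by (rule range_eqI[of _ _ "mpol_var j"]) (simp add: toric_map_eq)

text \<open>The first isomorphism theorem for \<open>toric_map a\<close>; it allows all later
  computation to take place inside a polynomial ring.\<close>

lemma semigroup_ring_iso:
  fixes k :: "'k::field itself" and a :: "'p::finite \<Rightarrow> nat ^ 'n::finite"
  shows "(\<lambda>C. the_elem (toric_map a ` C)) \<in>
    ring_iso (semigroup_ring k a) (ring_on (range (toric_map a :: ('p, 'k) mpol \<Rightarrow> _)))"
  using ring_hom_ring.FactRing_iso_set_aux[OF ring_hom_toric_map, of a]
  unfolding semigroup_ring_def toric_ideal_def ring_on_def by (simp add: ring_of_type_algebra_def)

lemma cring_semigroup_ring: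
  fixes k :: "'k::field itself" and a :: "'p::finite \<Rightarrow> nat ^ 'n::finite"
  shows "cring (semigroup_ring k a)"
  unfolding semigroup_ring_def
  by (rule ideal.quotient_is_cring[OF ideal_toric_ideal]) (rule cring_from_type_algebra)

lemma semigroup_ring_dim_eq:
  fixes k :: "'k::field itself" and a :: "'p::finite \<Rightarrow> nat ^ 'n::finite"
  shows "semigroup_ring_dim k a =
    krull_dim (ring_on (range (toric_map a :: ('p, 'k) mpol \<Rightarrow> _)))"
  unfolding semigroup_ring_dim_def
  using cring_semigroup_ring cring_ring_on[OF is_subring_range_toric_map] semigroup_ring_iso
  by (rule krull_dim_ring_iso)

lemma semigroup_ring_depth_eq:
  fixes k :: "'k::field itself" and a :: "'p::finite \<Rightarrow> nat ^ 'n::finite"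
  defines "T \<equiv> ring_on (range (toric_map a :: ('p, 'k) mpol \<Rightarrow> _))"
  shows "semigroup_ring_depth k a = depth T (Idl\<^bsub>T\<^esub> (range (\<lambda>j. vec_monom (a j))))"
proof -
  let ?R = "semigroup_ring k a" and ?h = "\<lambda>C. the_elem ((toric_map a :: ('p, 'k) mpol \<Rightarrow> _) ` C)"
  let ?x = "\<lambda>j. toric_ideal k a +>\<^bsub>mpol_ring\<^esub> mpol_var j"
  have T: "cring T" and h: "?h \<in> ring_iso ?R T"
    unfolding T_def using cring_ring_on[OF is_subring_range_toric_map] semigroup_ring_iso by auto
  have x: "range ?x \<subseteq> carrier ?R"
    by (auto simp: semigroup_ring_def FactRing_def A_RCOSETS_def' mpol_ring_eq)
  have "?h (?x j) = vec_monom (a j)" for j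
    using ring_hom_ring.the_elem_simp[OF ring_hom_toric_map[of a], of "mpol_var j :: ('p, 'k) mpol"]
    by (simp add: toric_ideal_def mpol_ring_eq) (simp add: toric_map_eq)
  then have "?h ` range ?x = range (\<lambda>j. vec_monom (a j))" by (simp add: image_image)
  moreover have "homogeneous_maximal_ideal k a \<subseteq> carrier ?R"
    unfolding homogeneous_maximal_ideal_def
    using ring.genideal_ideal[OF cring.axioms(1)[OF cring_semigroup_ring] x]
    by (simp add: additive_subgroup.a_subset ideal.axioms(1))
  ultimately show ?thesis
    unfolding semigroup_ring_depth_def
    using depth_ring_iso[OF cring_semigroup_ring T h] genideal_ring_iso[OF cring_semigroup_ring T h x]
    by (simp add: homogeneous_maximal_ideal_def)
qed

lemma noetherian_in_range_toric_map:
  fixes a :: "'p::finite \<Rightarrow> nat ^ 'n::finite"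
  shows "noetherian_in (range (toric_map a :: ('p, 'k::field) mpol \<Rightarrow> _))"
proof -
  let ?T = "range (toric_map a :: ('p, 'k) mpol \<Rightarrow> _)"
  let ?K = "range (mpol_const :: 'k \<Rightarrow> ('n, 'k) mpol)" and ?Y = "range (\<lambda>j. vec_monom (a j) :: ('n, 'k) mpol)"
  have K: "is_subring ?K"
    unfolding is_subring_def
  proof (intro conjI ballI)
    show "1 \<in> ?K" by (rule range_eqI[of _ _ 1]) simp
    fix x y assume "x \<in> ?K" "y \<in> ?K"
    then obtain c d where "x = mpol_const c" "y = mpol_const d" by blast
    then have "x - y = mpol_const (c + - d)" "x * y = mpol_const (c * d)"
      unfolding mpol_const_simps by simp_all
    then show "x - y \<in> ?K" "x * y \<in> ?K" by (metis rangeI)+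
  qed
  moreover have "noetherian_in ?K"
  proof (rule noetherian_in_field[OF K])
    fix x assume "x \<in> ?K" "x \<noteq> 0"
    then obtain c where c: "x = mpol_const c" by blast
    then have "c \<noteq> 0" using \<open>x \<noteq> 0\<close> by auto
    with c have "mpol_const (inverse c) * x = 1"
      by (simp del: mpol_const_simps(4) add: mpol_const_simps(4)[symmetric])
    then show "\<exists>y\<in>?K. y * x = 1" by blast
  qed
  moreover have "finite ?Y" by simp
  ultimately have "\<exists>B. is_subring B \<and> noetherian_in B \<and> ?K \<union> ?Y \<subseteq> B \<and>
      (\<forall>T. is_subring T \<longrightarrow> ?K \<union> ?Y \<subseteq> T \<longrightarrow> B \<subseteq> T)"
    by (rule noetherian_in_generated)
  then obtain B where B: "is_subring B" "noetherian_in B" "?K \<union> ?Y \<subseteq> B"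
    "\<forall>T. is_subring T \<longrightarrow> ?K \<union> ?Y \<subseteq> T \<longrightarrow> B \<subseteq> T"
    by (elim exE conjE)
  \<comment> \<open>Leastness of \<open>B\<close> gives this inclusion; the converse holds because
    every value of the toric map is a sum of constants times products of generators.\<close>
  have "B \<subseteq> ?T"
    using B(4) is_subring_range_toric_map range_toric_map_const range_toric_map_vec_monom by blast
  moreover have "toric_map a f \<in> B" for f :: "('p, 'k) mpol"
    unfolding toric_map_eq mpol_subst_eq_lin mpol_lin_def mpol_monom_def
    using B(3) by (intro is_subring_sum[OF B(1)] is_subring_closed(5)[OF B(1)]
        is_subring_prod[OF B(1)] is_subring_power[OF B(1)]) auto
  ultimately have "?T = B" by blast
  then show ?thesis using B(2) by simp
qed

text \<open>Evaluation at the origin. Through it the assumption of nonzero generators enters the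
  argument.\<close>

lemma mpol_subst_zero_vec_monom:
  assumes "v \<noteq> 0"
  shows "mpol_subst (\<lambda>_. 0) (vec_monom v :: ('n::finite, 'k::comm_ring_1) mpol) = (0 :: ('n, 'k) mpol)"
proof -
  obtain i where "v $ i \<noteq> 0" using assms by (auto simp: vec_eq_iff)
  then show ?thesis
    unfolding vec_monom_def mpol_subst_prod mpol_subst_power mpol_subst_var
    by (intro prod_zero) (auto intro!: exI[of _ i] zero_power)
qed

text \<open>Scaling the generators composes the toric map with the injective substitution raising
  each variable to the power \<open>k1\<close>, so the kernel is unchanged.\<close>

lemma toric_ideal_scale:
  fixes k :: "'k::field itself" and a :: "'p::finite \<Rightarrow> nat ^ 'n::finite"
  assumes "0 < k1"
  shows "toric_ideal k (\<lambda>j. k1 *s a j) = toric_ideal k a"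
proof -
  let ?F = "mpol_subst (\<lambda>i. mpol_var i ^ k1) :: ('n, 'k) mpol \<Rightarrow> ('n, 'k) mpol"
  have "?F (vec_monom v) = vec_monom (k1 *s v)" for v
    by (simp add: vec_monom_def mpol_subst_prod mpol_subst_power power_mult[symmetric])
  then have "toric_map (\<lambda>j. k1 *s a j) f = ?F (toric_map a f)" for f :: "('p, 'k) mpol"
    by (simp add: toric_map_eq mpol_subst_subst)
  then show ?thesis
    using mpol_subst_power_inj[OF assms] by (auto simp: toric_ideal_iff mpol_subst_hom)
qed

subsection \<open>Gluings\<close>

lemma prod_option:
  fixes g :: "'p::finite option \<Rightarrow> 'r::comm_monoid_mult"
  shows "(\<Prod>v\<in>UNIV. g v) = g None * (\<Prod>j\<in>UNIV. g (Some j))"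
  by (simp add: UNIV_option_conv prod.reindex)

lemma prime_in_power:
  "is_subring A \<Longrightarrow> prime_in A P \<Longrightarrow> x \<in> A \<Longrightarrow> x ^ n \<in> P \<Longrightarrow> x \<in> P"
  by (induction n) (auto simp: prime_in_def dest: is_subring_power)

locale gluing =
  fixes k1 k2 :: nat and a :: "'p::finite \<Rightarrow> nat ^ 'n::finite" and b :: "nat ^ 'n"
    and \<alpha> :: "'p \<Rightarrow> nat" and \<beta> :: nat and k :: "'k::field itself"
  assumes k1: "0 < k1" and k2: "0 < k2" and a: "a j \<noteq> 0" and b: "b \<noteq> 0"
    and binomial_nonzero: "(gluing_binomial \<alpha> \<beta> :: ('p option, 'k) mpol) \<noteq> 0"
    and toric_ideal_glue: "toric_ideal k (glue_family k1 k2 a b) =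
      Idl\<^bsub>mpol_ring\<^esub> (mpol_incl ` toric_ideal k a) <+>\<^bsub>mpol_ring\<^esub>
      Idl\<^bsub>mpol_ring\<^esub> {gluing_binomial \<alpha> \<beta>}"
begin

abbreviation c :: "'p option \<Rightarrow> nat ^ 'n" where "c \<equiv> glue_family k1 k2 a b"

abbreviation x :: "'p \<Rightarrow> ('n, 'k) mpol" where "x j \<equiv> vec_monom (k1 *s a j)"

abbreviation y :: "('n, 'k) mpol" where "y \<equiv> vec_monom (k2 *s b)"

abbreviation scaled_map :: "('p, 'k) mpol \<Rightarrow> ('n, 'k) mpol" where
  "scaled_map \<equiv> toric_map (\<lambda>j. k1 *s a j)"

abbreviation glue_map :: "('p option, 'k) mpol \<Rightarrow> ('n, 'k) mpol" where
  "glue_map \<equiv> toric_map c"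

abbreviation S :: "('n, 'k) mpol set" where "S \<equiv> range scaled_map"

abbreviation T :: "('n, 'k) mpol set" where "T \<equiv> range glue_map"

definition x_alpha :: "('n, 'k) mpol" where "x_alpha = (\<Prod>j\<in>UNIV. x j ^ \<alpha> j)"

text \<open>The map \<open>f(x, y) \<mapsto>\<close> coefficient of \<open>y\<^sup>i\<close> in the remainder of \<open>f\<close> modulo \<open>y\<^sup>\<beta> - x\<^sup>\<alpha>\<close>, with
  values in \<open>k[k\<^sub>1 A]\<close>.\<close>

definition component_weight :: "nat \<Rightarrow> ('p option \<Rightarrow>\<^sub>0 nat) \<Rightarrow> ('n, 'k) mpol" where
  "component_weight i m =
     (if Poly_Mapping.lookup m None mod \<beta> = i
      then (\<Prod>j\<in>UNIV. x j ^ Poly_Mapping.lookup m (Some j)) *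
        x_alpha ^ (Poly_Mapping.lookup m None div \<beta>)
      else 0)"

abbreviation component :: "nat \<Rightarrow> ('p option, 'k) mpol \<Rightarrow> ('n, 'k) mpol" where
  "component i \<equiv> mpol_lin (component_weight i)"

lemma c_simps [simp]: "c (Some j) = k1 *s a j" "c None = k2 *s b"
  by (simp_all add: glue_family_def)

lemma vec_nonzero: "k1 *s a j \<noteq> 0" "k2 *s b \<noteq> 0"
proof -
  obtain i where "a j $ i \<noteq> 0" using a[of j] by (auto simp: vec_eq_iff)
  then show "k1 *s a j \<noteq> 0" using k1 by (auto simp: vec_eq_iff)
  obtain i where "b $ i \<noteq> 0" using b by (auto simp: vec_eq_iff)
  then show "k2 *s b \<noteq> 0" using k2 by (auto simp: vec_eq_iff)
qed

lemma is_subring_S: "is_subring S" and is_subring_T: "is_subring T"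
  by (rule is_subring_range_toric_map)+

lemma x_mem_S: "x j \<in> S"
  by (rule range_toric_map_vec_monom)

lemma y_mem_T: "y \<in> T"
  using range_toric_map_vec_monom[of c None] by simp

lemma glue_map_incl: "glue_map (mpol_incl f) = scaled_map f"
  by (simp add: toric_map_eq mpol_incl_def mpol_subst_subst)

lemma S_subset_T: "S \<subseteq> T"
  using glue_map_incl by (metis image_subsetI rangeI)

lemma binomial_mem: "gluing_binomial \<alpha> \<beta> \<in> toric_ideal k c"
proof -
  interpret R: cring "mpol_ring :: ('p option, 'k) mpol ring" by (rule cring_from_type_algebra)
  have "0 \<in> Idl\<^bsub>mpol_ring\<^esub> (mpol_incl ` toric_ideal k a)"
    using additive_subgroup.zero_closed[OF ideal.axioms(1)[OF R.genideal_ideal]]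
    by (simp add: mpol_ring_eq)
  moreover have "gluing_binomial \<alpha> \<beta> \<in> Idl\<^bsub>mpol_ring\<^esub> {gluing_binomial \<alpha> \<beta> :: ('p option, 'k) mpol}"
    by (rule R.genideal_self') (simp add: mpol_ring_eq)
  ultimately show ?thesis
    unfolding toric_ideal_glue set_add_def' by (force simp: mpol_ring_eq)
qed

lemma y_power: "y ^ \<beta> = x_alpha"
  using binomial_mem
  by (simp add: toric_ideal_iff gluing_binomial_def toric_map_eq mpol_subst_hom mpol_subst_prod
      mpol_subst_power x_alpha_def)

abbreviation at_zero :: "('n, 'k) mpol \<Rightarrow> ('n, 'k) mpol" where
  "at_zero \<equiv> mpol_subst (\<lambda>_. 0)"

lemma at_zero_x: "at_zero (x j) = 0" and at_zero_y: "at_zero y = 0"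
  using mpol_subst_zero_vec_monom vec_nonzero by blast+

lemma at_zero_x_alpha: "at_zero x_alpha = 0" if "\<alpha> j \<noteq> 0"
  unfolding x_alpha_def mpol_subst_prod mpol_subst_power
  using that by (intro prod_zero bexI[of _ j]) (simp_all add: at_zero_x zero_power)

text \<open>If \<open>\<beta> = 0\<close>, then \<open>x_alpha = 1\<close>. Evaluation at the origin
  forces every exponent \<open>\<alpha> j\<close> to vanish, and the binomial becomes
  \<open>1 - 1\<close>, which is excluded.\<close>

lemma beta_pos: "0 < \<beta>"
proof (rule ccontr)
  assume "\<not> 0 < \<beta>"
  then have \<beta>: "\<beta> = 0" by simp
  then have "x_alpha = 1" using y_power by simp
  then have "at_zero x_alpha = 1" by (simp add: mpol_subst_hom)
  then have "\<alpha> j = 0" for j using at_zero_x_alpha[of j] by auto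
  then have "gluing_binomial \<alpha> \<beta> = (0 :: ('p option, 'k) mpol)"
    using \<beta> by (simp add: gluing_binomial_def)
  then show False using binomial_nonzero by simp
qed

lemma alpha_nonzero: "\<exists>j. \<alpha> j \<noteq> 0"
proof (rule ccontr)
  assume "\<nexists>j. \<alpha> j \<noteq> 0"
  then have "y ^ \<beta> = 1" unfolding y_power by (simp add: x_alpha_def)
  then have "at_zero (y ^ \<beta>) = 1" by (simp add: mpol_subst_hom)
  then show False using beta_pos by (simp add: mpol_subst_power at_zero_y zero_power)
qed

text \<open>A factor \<open>x j\<close> leaves the exponent of the extra variable alone, hence also
  its quotient and remainder by \<open>\<beta>\<close>. So taking components is linear over
  \<open>S\<close>.\<close>

lemma component_incl_mult: "component i (mpol_incl g * h) = scaled_map g * component i h"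
  unfolding mpol_incl_def toric_map_eq
proof (rule mpol_lin_subst_mult)
  fix j h
  have "component_weight i (Poly_Mapping.single (Some j) 1 + m) = x j * component_weight i m" for m
  proof -
    have "(\<Prod>l\<in>UNIV. x l ^ Poly_Mapping.lookup (Poly_Mapping.single (Some j) 1 + m) (Some l)) =
        (\<Prod>l\<in>UNIV. (if l = j then x l else 1) * x l ^ Poly_Mapping.lookup m (Some l))"
      by (intro prod.cong) (auto simp: lookup_add lookup_single when_def)
    also have "\<dots> = x j * (\<Prod>l\<in>UNIV. x l ^ Poly_Mapping.lookup m (Some l))"
      by (simp add: prod.distrib)
    finally show ?thesis
      by (simp add: component_weight_def lookup_add lookup_single when_def mult.assoc)
  qed
  then show "component i (mpol_var (Some j) * h) = x j * component i h"
    unfolding mpol_var_def by (rule mpol_lin_shift)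
qed

text \<open>Both terms of the binomial scale a component by \<open>x_alpha\<close>: the first by
  linearity, the second because adding \<open>\<beta>\<close> to the last exponent keeps its
  remainder and raises its quotient by one.\<close>

lemma component_binomial_mult: "component i (gluing_binomial \<alpha> \<beta> * h) = 0"
proof -
  have "component i (mpol_var (Some j) * h) = x j * component i h" for j h
    using component_incl_mult[of i "mpol_var j" h] by (simp add: mpol_incl_def toric_map_eq)
  then have "component i ((\<Prod>j\<in>UNIV. mpol_var (Some j) ^ \<alpha> j) * h) = x_alpha * component i h"
    unfolding x_alpha_def by (rule mpol_lin_prod_mult)
  moreover have "component i (mpol_var None ^ \<beta> * h) = x_alpha * component i h"
    unfolding mpol_var_power
  proof (rule mpol_lin_shift)
    show "component_weight i (Poly_Mapping.single None \<beta> + m) = x_alpha * component_weight i m" for m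
      using beta_pos
      by (simp add: component_weight_def lookup_add lookup_single when_def mult.left_commute)
  qed
  ultimately show ?thesis by (simp add: gluing_binomial_def left_diff_distrib mpol_lin_diff)
qed

text \<open>By this the components depend only on the image under \<open>glue_map\<close>, so they
  are well-defined coordinate functions on \<open>T\<close>. Here the prescribed form of the toric
  ideal is essential.\<close>

lemma component_toric_ideal:
  assumes "f \<in> toric_ideal k c"
  shows "component i f = 0"
proof -
  interpret R: cring "mpol_ring :: ('p option, 'k) mpol ring" by (rule cring_from_type_algebra)
  \<comment> \<open>The kernel of a component need not be an ideal. Requiring that all multiples be
    killed makes it one, so generators suffice.\<close>
  define Z where "Z = {f. \<forall>h. component i (f * h) = 0}"
  have "ideal_in UNIV Z"
    unfolding ideal_in_def
  proof (intro conjI ballI)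
    show "0 \<in> Z" by (simp add: Z_def)
    show "f + g \<in> Z" if "f \<in> Z" "g \<in> Z" for f g
      using that by (simp add: Z_def ring_distribs mpol_lin_add)
    show "g * f \<in> Z" if f: "f \<in> Z" for f g
    proof -
      have "component i (g * f * h) = component i (f * (g * h))" for h by (simp add: ac_simps)
      then show ?thesis using f by (simp add: Z_def)
    qed
  qed simp
  then have Z: "ideal Z mpol_ring"
    unfolding mpol_ring_eq using ideal_ring_on_iff[of UNIV Z] by (simp add: is_subring_def)
  have "Idl\<^bsub>mpol_ring\<^esub> (mpol_incl ` toric_ideal k a) \<subseteq> Z"
  proof (rule R.genideal_minimal[OF Z])
    have "scaled_map g = 0" if "g \<in> toric_ideal k a" for g
      using that toric_ideal_iff[of g k "\<lambda>j. k1 *s a j"] toric_ideal_scale[OF k1, of k a]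
      by metis
    then show "mpol_incl ` toric_ideal k a \<subseteq> Z"
      by (auto simp: Z_def component_incl_mult)
  qed
  moreover have "Idl\<^bsub>mpol_ring\<^esub> {gluing_binomial \<alpha> \<beta>} \<subseteq> Z"
    by (rule R.genideal_minimal[OF Z]) (simp add: Z_def component_binomial_mult)
  ultimately have "f \<in> Z"
    using assms ideal_in_closed(3)[OF \<open>ideal_in UNIV Z\<close>]
    unfolding toric_ideal_glue set_add_def' by (auto simp: mpol_ring_eq)
  then have "component i (f * 1) = 0" unfolding Z_def by blast
  then show ?thesis by simp
qed

text \<open>Spanning comes from replacing \<open>y ^ \<beta>\<close> by \<open>x_alpha\<close> in
  every monomial. For independence, a relation over \<open>S\<close> is lifted to a polynomial in
  the toric ideal, whose components are the given coefficients.\<close>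

lemma free_extension: "free_extension S T {..<\<beta>} (\<lambda>i. y ^ i) 0"
proof
  show "is_subring S" "is_subring T" "S \<subseteq> T" "finite {..<\<beta>}" "0 \<in> {..<\<beta>}" "y ^ 0 = 1"
    using is_subring_S is_subring_T S_subset_T beta_pos by simp_all
  show "y ^ i \<in> T" if "i \<in> {..<\<beta>}" for i using is_subring_power[OF is_subring_T y_mem_T] .
next
  fix t assume "t \<in> T"
  then obtain f where "t = glue_map f" by blast
  moreover have "\<exists>s. (\<forall>i\<in>{..<\<beta>}. s i \<in> S) \<and> glue_map f = (\<Sum>i<\<beta>. s i * y ^ i)"
  proof (induction f rule: mpol_induct)
    case (single m d)
    define q where "q = mpol_const d * (\<Prod>j\<in>UNIV. x j ^ Poly_Mapping.lookup m (Some j)) *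
      x_alpha ^ (Poly_Mapping.lookup m None div \<beta>)"
    let ?r = "Poly_Mapping.lookup m None mod \<beta>"
    have "q \<in> S"
      unfolding q_def x_alpha_def
      by (intro is_subring_closed(5)[OF is_subring_S] is_subring_prod[OF is_subring_S]
          is_subring_power[OF is_subring_S] x_mem_S range_toric_map_const)
    have "y ^ Poly_Mapping.lookup m None =
        (y ^ \<beta>) ^ (Poly_Mapping.lookup m None div \<beta>) * y ^ ?r"
      by (simp add: power_mult[symmetric] power_add[symmetric])
    then have "glue_map (Poly_Mapping.single m d) = q * y ^ ?r"
      by (simp add: toric_map_eq mpol_subst_eq_lin mpol_monom_def prod_option q_def y_power ac_simps)
    also have "\<dots> = (\<Sum>i<\<beta>. if i = ?r then q * y ^ i else 0)" using beta_pos by simp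
    also have "\<dots> = (\<Sum>i<\<beta>. (if i = ?r then q else 0) * y ^ i)" by (intro sum.cong) auto
    finally show ?case
      using \<open>q \<in> S\<close> is_subring_closed(2)[OF is_subring_S]
      by (intro exI[of _ "\<lambda>i. if i = ?r then q else 0"]) simp
  next
    case (add f g)
    then obtain s s' where *: "\<forall>i\<in>{..<\<beta>}. s i \<in> S" "glue_map f = (\<Sum>i<\<beta>. s i * y ^ i)"
      "\<forall>i\<in>{..<\<beta>}. s' i \<in> S" "glue_map g = (\<Sum>i<\<beta>. s' i * y ^ i)"
      by (elim exE conjE)
    have "glue_map (f + g) = (\<Sum>i<\<beta>. (s i + s' i) * y ^ i)"
      using *(2,4) by (simp add: toric_map_eq mpol_subst_hom ring_distribs sum.distrib)
    moreover have "\<forall>i\<in>{..<\<beta>}. s i + s' i \<in> S"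
      using *(1,3) is_subring_closed(6)[OF is_subring_S] by simp
    ultimately show ?case by (intro exI[of _ "\<lambda>i. s i + s' i"]) simp
  qed
  ultimately show "\<exists>s. (\<forall>i\<in>{..<\<beta>}. s i \<in> S) \<and> t = (\<Sum>i<\<beta>. s i * y ^ i)" by simp
next
  fix s assume s: "\<forall>i\<in>{..<\<beta>}. s i \<in> S" and zero: "(\<Sum>i<\<beta>. s i * y ^ i) = 0"
  then have "\<forall>i\<in>{..<\<beta>}. \<exists>f. s i = scaled_map f" by blast
  from bchoice[OF this] obtain f where f: "\<forall>i\<in>{..<\<beta>}. s i = scaled_map (f i)" ..
  define F where "F = (\<Sum>i<\<beta>. mpol_incl (f i) * mpol_var None ^ i)"
  have "glue_map F = (\<Sum>i<\<beta>. glue_map (mpol_incl (f i)) * y ^ i)"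
    unfolding F_def by (simp add: toric_map_eq mpol_subst_hom mpol_subst_sum mpol_subst_power)
  also have "\<dots> = (\<Sum>i<\<beta>. s i * y ^ i)" using f by (intro sum.cong) (auto simp: glue_map_incl)
  finally have "F \<in> toric_ideal k c" using zero by (simp add: toric_ideal_iff)
  then have comp: "component j F = 0" for j by (rule component_toric_ideal)
  show "\<forall>i\<in>{..<\<beta>}. s i = 0"
  proof
    fix j assume j: "j \<in> {..<\<beta>}"
    have "component j F = (\<Sum>i<\<beta>. scaled_map (f i) * component j (mpol_var None ^ i))"
      unfolding F_def by (simp add: mpol_lin_sum component_incl_mult)
    \<comment> \<open>As \<open>i < \<beta>\<close>, the exponent \<open>i\<close> has quotient 0
      and remainder \<open>i\<close>, so the component of this power is 1 for \<open>i = j\<close>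
      and 0 otherwise.\<close>
    also have "\<dots> = (\<Sum>i<\<beta>. if i = j then s i else 0)"
      using f by (intro sum.cong)
        (auto simp: mpol_var_power component_weight_def lookup_single when_def)
    also have "\<dots> = s j" using j by simp
    finally show "s j = 0" using comp by simp
  qed
qed

lemma dim_eq: "semigroup_ring_dim k a = semigroup_ring_dim k c"
  and depth_eq: "semigroup_ring_depth k a = semigroup_ring_depth k c"
proof -
  interpret free_extension S T "{..<\<beta>}" "\<lambda>i. y ^ i" 0 by (rule free_extension)
  \<comment> \<open>\<open>S\<close> belongs to the scaled family, but ring and maximal ideal are
    built from the toric ideal and the variables alone, so scaling does not change them.\<close>
  have scale: "semigroup_ring k (\<lambda>j. k1 *s a j) = semigroup_ring k a"
    "homogeneous_maximal_ideal k (\<lambda>j. k1 *s a j) = homogeneous_maximal_ideal k a"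
    by (simp_all add: semigroup_ring_def homogeneous_maximal_ideal_def toric_ideal_scale[OF k1])
  have noeth: "noetherian_in T" by (rule noetherian_in_range_toric_map)
  show "semigroup_ring_dim k a = semigroup_ring_dim k c"
    using krull_dim_eq[OF noeth] semigroup_ring_dim_eq[of k "\<lambda>j. k1 *s a j"]
      semigroup_ring_dim_eq[of k c]
    by (simp add: semigroup_ring_dim_def scale)
  define M where "M = Idl\<^bsub>ring_on S\<^esub> (range x)"
  define N where "N = Idl\<^bsub>ring_on T\<^esub> (range (\<lambda>j. vec_monom (c j)))"
  have xS: "range x \<subseteq> S" using x_mem_S by blast
  have xT: "range (\<lambda>j. vec_monom (c j)) \<subseteq> T" by (auto intro: range_toric_map_vec_monom)
  have M: "ideal_in S M" and N: "ideal_in T N"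
    unfolding M_def N_def using ideal_in_genideal is_subring_S is_subring_T xS xT by blast+
  have x_M: "x j \<in> M" for j unfolding M_def using genideal_superset[OF is_subring_S xS] by blast
  have gen_N: "vec_monom (c j) \<in> N" for j
    unfolding N_def using genideal_superset[OF is_subring_T xT] by blast
  \<comment> \<open>Properness of \<open>M\<close>: all its elements vanish at the origin, whereas 1
    does not.\<close>
  have "M \<subseteq> {f \<in> S. at_zero f = 0}"
    unfolding M_def
  proof (rule genideal_subset[OF is_subring_S xS])
    show "ideal_in S {f \<in> S. at_zero f = 0}"
      unfolding ideal_in_def using is_subring_closed[OF is_subring_S] by (simp add: mpol_subst_hom subset_iff)
    show "range x \<subseteq> {f \<in> S. at_zero f = 0}" using x_mem_S at_zero_x by blast
  qed
  moreover have "at_zero 1 \<noteq> 0" by (simp add: mpol_subst_hom)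
  ultimately have M1: "1 \<notin> M" by blast
  have "range x \<subseteq> N \<inter> S" using gen_N[of "Some _"] xS by auto
  then have "M \<subseteq> N \<inter> S"
    unfolding M_def by (rule genideal_subset[OF is_subring_S xS ideal_in_restrict[OF is_subring_S S_subset_T N]])
  then have MN: "M \<subseteq> N" by blast
  \<comment> \<open>One positive exponent is enough; that there is one is the content of
    \<open>alpha_nonzero\<close>.\<close>
  have "x_alpha \<in> M"
  proof -
    obtain j where j: "\<alpha> j \<noteq> 0" using alpha_nonzero ..
    have "x j ^ \<alpha> j \<in> M"
      using j is_subring_power[OF is_subring_S x_mem_S] ideal_in_closed(5)[OF M _ x_M]
      by (cases "\<alpha> j") simp_all
    then show ?thesis
      unfolding x_alpha_def
      by (intro ideal_in_prod[OF is_subring_S M, of UNIV j] is_subring_power[OF is_subring_S] x_mem_S) simp_all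
  qed
  have "\<forall>P. prime_in T P \<longrightarrow> M \<subseteq> P \<longrightarrow> N \<subseteq> P"
  proof (intro allI impI)
    fix P assume P: "prime_in T P" and MP: "M \<subseteq> P"
    have "y ^ \<beta> \<in> P" using \<open>x_alpha \<in> M\<close> MP y_power by auto
    then have "y \<in> P" using prime_in_power[OF is_subring_T P y_mem_T] by blast
    then have "vec_monom (c j) \<in> P" for j using x_M MP by (cases j) auto
    then show "N \<subseteq> P"
      unfolding N_def using P by (intro genideal_subset[OF is_subring_T xT]) (auto simp: prime_in_def)
  qed
  moreover have "N \<subseteq> T" using N by (simp add: ideal_in_def)
  ultimately have "depth (ring_on S) M = depth (ring_on T) N" by (intro depth_eq[OF noeth M M1 MN])
  then show "semigroup_ring_depth k a = semigroup_ring_depth k c"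
    using semigroup_ring_depth_eq[of k "\<lambda>j. k1 *s a j"] semigroup_ring_depth_eq[of k c]
    unfolding M_def N_def by (simp add: semigroup_ring_depth_def scale)
qed

end

theorem corollary3p6:
  fixes a :: "'p::finite \<Rightarrow> nat ^ 'n::finite" and b :: "nat ^ 'n" and k1 k2 :: nat
  assumes a_nonzero: "\<And>j. a j \<noteq> 0"
    and b_nonzero: "b \<noteq> 0"
    and glueable: "can_be_glued TYPE('k::field) a b"
    and gluing: "is_gluing TYPE('k) k1 k2 a b"
  shows "semigroup_ring_dim TYPE('k) a = semigroup_ring_dim TYPE('k) (glue_family k1 k2 a b)
    \<and> semigroup_ring_depth TYPE('k) a = semigroup_ring_depth TYPE('k) (glue_family k1 k2 a b)
    \<and> (semigroup_ring_CM TYPE('k) (glue_family k1 k2 a b) \<longleftrightarrow> semigroup_ring_CM TYPE('k) a)"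
proof -
  obtain \<alpha> \<beta> where "gluing k1 k2 a b \<alpha> \<beta> TYPE('k)"
    using gluing a_nonzero b_nonzero unfolding is_gluing_def gluing_def by blast
  then interpret gluing k1 k2 a b \<alpha> \<beta> "TYPE('k)" .
  show ?thesis using dim_eq depth_eq by (simp add: semigroup_ring_CM_def)
qed

end
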